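(* Let $A$ be a commutative Noetherian ring containing a field $K$ of characteristic zero, let $m\ge 1$, and let $R=A[X_1,\ldots,X_m]$ be standard graded over $A$. Let $I$ be a homogeneous ideal of $R$, let $i\ge 0$, and let $M:=H^i_I(R)=\bigoplus_{n\in\mathbb{Z}}M_n$. Then: (a) The following are equivalent: (i) $M_n\neq 0$ for infinitely many $n\ll 0$; (ii) $M_n\ne 0$ for all $n\le -m$. (b) The following are equivalent: (i) $M_n\neq 0$ for infinitely many $n\gg 0$; (ii) $M_n\neq 0$ for all $n\ge 0$.
   Context: The standard grading on $R=A[X_1,\ldots,X_m]$ is given by $\deg z=0$ for all $z\in A$ and $\deg X_j=1$ for $j=1,\ldots,m$. For a homogeneous ideal $I$, $H^i_I(R)$ is the $i$-th local cohomology module of $R$ with support in $I$, with its natural structure of $\mathbb{Z}$-graded $R$-module; $M_n$ denotes its degree $n$ component. "For infinitely many $n\ll 0$" (resp. $n\gg 0$) means for infinitely many negative (resp. positive) integers $n$. *)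

theory Defs
  imports
    "HOL-Library.Cardinality"
    "HOL-Library.Poly_Mapping"
    "HOL-Algebra.Algebraic_Closure_Type"
    "HOL-Algebra.Ideal_Product"
    "HOL-Algebra.Ring_Divisibility"
    "HOL-Algebra.Module"
begin

section \<open>The standard graded polynomial ring\<close>

text \<open>
  The coefficient ring \<open>A\<close> is a type \<open>'a\<close>, and the variables \<open>X\<^sub>1, \<dots>, X\<^sub>m\<close> are indexed by a
  (nonempty) finite type \<open>'v\<close>, so that \<open>m = CARD('v) \<ge> 1\<close>. A monomial is an exponent vector
  \<open>'v \<Rightarrow>\<^sub>0 nat\<close>, and a polynomial maps monomials to their coefficients.
\<close>

type_synonym ('v, 'a) mpolynomial = "('v \<Rightarrow>\<^sub>0 nat) \<Rightarrow>\<^sub>0 'a"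

abbreviation poly_ring :: "('v, 'a::comm_ring_1) mpolynomial ring"
  where "poly_ring \<equiv> ring_of_type_algebra"

definition monomial_degree :: "('v::finite \<Rightarrow>\<^sub>0 nat) \<Rightarrow> nat"
  where "monomial_degree t = (\<Sum>v\<in>UNIV. Poly_Mapping.lookup t v)"

text \<open>
  As in \<^theory>\<open>HOL-Algebra.Module\<close>, the fields \<open>mult\<close> and \<open>one\<close> of a module record carry no
  meaning.
\<close>

record ('r, 'b) graded_module = "('r, 'b) module" +
  grade :: "int \<Rightarrow> 'b set"

definition poly_graded ::
    "(('v::finite, 'a::comm_ring_1) mpolynomial, ('v, 'a) mpolynomial) graded_module"
  where "poly_graded =
    \<lparr> carrier = UNIV, monoid.mult = (*), one = 1, ring.zero = 0, add = (+), module.smult = (*),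
      grade = (\<lambda>n. {p. \<forall>t\<in>Poly_Mapping.keys p. int (monomial_degree t) = n}) \<rparr>"

definition homogeneous_ideal :: "('v::finite, 'a::comm_ring_1) mpolynomial set \<Rightarrow> bool"
  where "homogeneous_ideal I \<longleftrightarrow>
    ideal I poly_ring \<and> (\<exists>S. S \<subseteq> (\<Union>n. grade poly_graded n) \<and> I = Idl\<^bsub>poly_ring\<^esub> S)"


section \<open>Graded modules\<close>

locale graded_module = module poly_ring M
  for M :: "(('v::finite, 'a::comm_ring_1) mpolynomial, 'b, 'c) graded_module_scheme" (structure) +
  assumes grade_subgroup: "additive_subgroup (grade M n) M"
    and grade_smult: "\<lbrakk> p \<in> grade poly_graded k; x \<in> grade M n \<rbrakk> \<Longrightarrow> p \<odot> x \<in> grade M (k + n)"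
    and grade_direct_sum: "x \<in> carrier M \<Longrightarrow>
      \<exists>!c. (\<forall>n. c n \<in> grade M n) \<and> finite {n. c n \<noteq> \<zero>\<^bsub>M\<^esub>} \<and>
           x = finsum M c {n. c n \<noteq> \<zero>\<^bsub>M\<^esub>}"

text \<open>Homomorphisms of graded modules are homogeneous of degree 0.\<close>

definition graded_hom ::
    "(('v::finite, 'a::comm_ring_1) mpolynomial, 'b, 'c) graded_module_scheme \<Rightarrow>
     (('v, 'a) mpolynomial, 'd, 'e) graded_module_scheme \<Rightarrow> ('b \<Rightarrow> 'd) set"
  where "graded_hom M N = {h \<in> carrier M \<rightarrow> carrier N.
    (\<forall>x\<in>carrier M. \<forall>y\<in>carrier M. h (x \<oplus>\<^bsub>M\<^esub> y) = h x \<oplus>\<^bsub>N\<^esub> h y) \<and>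
    (\<forall>p. \<forall>x\<in>carrier M. h (p \<odot>\<^bsub>M\<^esub> x) = p \<odot>\<^bsub>N\<^esub> h x) \<and>
    (\<forall>n. h ` grade M n \<subseteq> grade N n)}"

text \<open>
  Injective objects of the category of graded modules. The test modules \<open>L\<close> and \<open>M\<close> range over the
  graded modules whose elements lie in the same type \<open>'e\<close> as those of \<open>E\<close>. By Baer's criterion this
  is injectivity among all graded modules as soon as the polynomial ring embeds into \<open>'e\<close>, which is
  always the case for the resolutions below.
\<close>

definition graded_injective ::
    "(('v::finite, 'a::comm_ring_1) mpolynomial, 'e) graded_module \<Rightarrow> bool"
  where "graded_injective E \<longleftrightarrow> graded_module E \<and>
    (\<forall>(L :: (('v, 'a) mpolynomial, 'e) graded_module) (M :: (('v, 'a) mpolynomial, 'e) graded_module).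
      \<forall>j\<in>graded_hom L M. \<forall>f\<in>graded_hom L E.
        graded_module L \<and> graded_module M \<and> inj_on j (carrier L) \<longrightarrow>
        (\<exists>g\<in>graded_hom M E. \<forall>x\<in>carrier L. g (j x) = f x))"


section \<open>Local cohomology\<close>

text \<open>
  \<open>0 \<rightarrow> R \<rightarrow> E 0 \<rightarrow> E 1 \<rightarrow> \<dots>\<close> is an injective resolution of the polynomial ring \<open>R\<close>, with augmentation
  \<open>\<epsilon>\<close> and differentials \<open>d i\<close>, in the category of graded modules.
\<close>

definition graded_injective_resolution ::
    "(('v::finite, 'a::comm_ring_1) mpolynomial \<Rightarrow> 'e) \<Rightarrow>
     (nat \<Rightarrow> (('v, 'a) mpolynomial, 'e) graded_module) \<Rightarrow> (nat \<Rightarrow> 'e \<Rightarrow> 'e) \<Rightarrow> bool"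
  where "graded_injective_resolution \<epsilon> E d \<longleftrightarrow>
    (\<forall>i. graded_injective (E i)) \<and>
    \<epsilon> \<in> graded_hom poly_graded (E 0) \<and>
    (\<forall>i. d i \<in> graded_hom (E i) (E (Suc i))) \<and>
    inj \<epsilon> \<and>
    range \<epsilon> = {x \<in> carrier (E 0). d 0 x = \<zero>\<^bsub>E (Suc 0)\<^esub>} \<and>
    (\<forall>i. d i ` carrier (E i) = {x \<in> carrier (E (Suc i)). d (Suc i) x = \<zero>\<^bsub>E (Suc (Suc i))\<^esub>})"

text \<open>The \<open>I\<close>-torsion \<open>\<Gamma>\<^sub>I(M)\<close>; powers of ideals are those of the monoid of ideals.\<close>

definition torsion ::
    "('v::finite, 'a::comm_ring_1) mpolynomial set \<Rightarrow>
     (('v, 'a) mpolynomial, 'e) graded_module \<Rightarrow> 'e set"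
  where "torsion I M = {x \<in> carrier M.
    \<exists>t::nat. \<forall>p \<in> I [^]\<^bsub>ideals_set poly_ring\<^esub> t. p \<odot>\<^bsub>M\<^esub> x = \<zero>\<^bsub>M\<^esub>}"

definition cocycles ::
    "('v::finite, 'a::comm_ring_1) mpolynomial set \<Rightarrow>
     (nat \<Rightarrow> (('v, 'a) mpolynomial, 'e) graded_module) \<Rightarrow> (nat \<Rightarrow> 'e \<Rightarrow> 'e) \<Rightarrow> nat \<Rightarrow> 'e set"
  where "cocycles I E d i = {z \<in> torsion I (E i). d i z = \<zero>\<^bsub>E (Suc i)\<^esub>}"

definition coboundaries ::
    "('v::finite, 'a::comm_ring_1) mpolynomial set \<Rightarrow>
     (nat \<Rightarrow> (('v, 'a) mpolynomial, 'e) graded_module) \<Rightarrow> (nat \<Rightarrow> 'e \<Rightarrow> 'e) \<Rightarrow> nat \<Rightarrow> 'e set"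
  where "coboundaries I E d i =
    (case i of 0 \<Rightarrow> {\<zero>\<^bsub>E 0\<^esub>} | Suc j \<Rightarrow> d j ` torsion I (E j))"

text \<open>
  The graded module \<open>H\<^sup>i\<^sub>I(R) = H\<^sup>i(\<Gamma>\<^sub>I(E))\<close>, the \<open>i\<close>-th right derived functor of \<open>\<Gamma>\<^sub>I\<close> at \<open>R\<close>,
  computed from a graded injective resolution \<open>E\<close> of \<open>R\<close>. Its elements are the cosets of the
  coboundaries in the cocycles, and its component of degree \<open>n\<close> consists of the cosets of the cocycles
  that are homogeneous of degree \<open>n\<close>.
\<close>

definition local_cohomology ::
    "('v::finite, 'a::comm_ring_1) mpolynomial set \<Rightarrow>
     (nat \<Rightarrow> (('v, 'a) mpolynomial, 'e) graded_module) \<Rightarrow> (nat \<Rightarrow> 'e \<Rightarrow> 'e) \<Rightarrow> nat \<Rightarrow>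
     (('v, 'a) mpolynomial, 'e set) graded_module"
  where "local_cohomology I E d i =
    (let Z = cocycles I E d i; B = coboundaries I E d i in
      \<lparr> carrier = (\<lambda>z. B +>\<^bsub>E i\<^esub> z) ` Z,
        monoid.mult = undefined,
        one = undefined,
        ring.zero = B,
        add = set_add (E i),
        module.smult = (\<lambda>p C. \<Union>c\<in>C. B +>\<^bsub>E i\<^esub> (p \<odot>\<^bsub>E i\<^esub> c)),
        grade = (\<lambda>n. (\<lambda>z. B +>\<^bsub>E i\<^esub> z) ` (Z \<inter> grade (E i) n)) \<rparr>)"

end

theory Submission
  imports Defs
begin

text \<open>
  The partial derivatives \<open>\<partial>\<^sub>v\<close> of \<open>R\<close> act on \<open>M = H\<^sup>i\<^sub>I(R)\<close> with degree \<open>- 1\<close>, and the Euler operator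
  \<open>\<Sum> X\<^sub>v \<partial>\<^sub>v\<close> is multiplication by \<open>n\<close> on \<open>M\<^sub>n\<close>. As nonzero integers are invertible in \<open>A\<close>, this already
  forces the rigidity of the degrees. If \<open>M\<^sub>n = 0\<close> with \<open>n \<ge> 0\<close> and \<open>z \<in> M\<^bsub>n+1\<^esub>\<close>, then every \<open>\<partial>\<^sub>v z\<close> lies in \<open>M\<^sub>n\<close>,
  so \<open>(n + 1) z = \<Sum> X\<^sub>v \<partial>\<^sub>v z = 0\<close> and \<open>z = 0\<close>. If \<open>M\<^sub>n = 0\<close> with \<open>n \<le> - m\<close> and \<open>z \<in> M\<^bsub>n-1\<^esub>\<close>, then
  every \<open>X\<^sub>v z\<close> lies in \<open>M\<^sub>n\<close>, and \<open>0 = \<Sum> \<partial>\<^sub>v X\<^sub>v z = (m + n - 1) z\<close> with \<open>m + n - 1 < 0\<close>, so again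
  \<open>z = 0\<close>. Hence one vanishing component at \<open>n \<ge> 0\<close> kills all components above it, and one at
  \<open>n \<le> - m\<close> all components below it; these are the steps \<open>vanishing_up\<close> and \<open>vanishing_down\<close>.

  The partial derivatives are not \<open>R\<close>-linear, so their action on \<open>M\<close> does not come from
  functoriality alone. It is built on the given injective resolution. An additive map \<open>\<theta>\<close> with
  \<open>\<theta> (p x) = p \<theta> x + \<delta> p x\<close>, here called a connection over the derivation \<open>\<delta>\<close>, is the same as an
  \<open>R\<close>-linear splitting of the self-extension \<open>E \<oplus> E\<close> with the scalar multiplication
  \<open>p (x, y) = (p x, p y + \<delta> p x)\<close>. Injectivity of \<open>E\<close> yields such splittings, even with prescribed
  values on a graded submodule (\<open>connection_extend\<close>), so \<open>\<delta>\<close> lifts to connections \<open>\<theta>\<close> on all terms of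
  the resolution that commute with the differentials (\<open>lift_derivation\<close>). By the Leibniz rule they
  preserve \<open>I\<close>-torsion, hence act on the cohomology of \<open>\<Gamma>\<^sub>I(E)\<close>.

  For lifts \<open>\<theta>\<^sub>v\<close> of the \<open>\<partial>\<^sub>v\<close>, the operator \<open>\<Sum> X\<^sub>v \<theta>\<^sub>v\<close> and the operator that multiplies each
  homogeneous element by its degree are connections over the same derivation. Their difference is
  therefore an \<open>R\<close>-linear chain map, and by Euler's formula it lifts the zero map of \<open>R\<close>. It is null-homotopic
  (\<open>null_homotopy\<close>), which gives the Euler relation on cohomology (\<open>euler_on_cocycles\<close>).
\<close>

section \<open>Derivations of the polynomial ring\<close>

lemma poly_ring_simps [simp]:
  "carrier ring_of_type_algebra = UNIV"
  "x \<otimes>\<^bsub>ring_of_type_algebra\<^esub> y = x * y"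
  "\<one>\<^bsub>ring_of_type_algebra\<^esub> = 1"
  "\<zero>\<^bsub>ring_of_type_algebra\<^esub> = 0"
  "x \<oplus>\<^bsub>ring_of_type_algebra\<^esub> y = x + y"
  by (simp_all add: ring_of_type_algebra_def)

lemma mpolynomial_induct [case_names monomial add]:
  fixes p :: "('v, 'a::comm_ring_1) mpolynomial"
  assumes "\<And>t a. P (Poly_Mapping.single t a)" and "\<And>p q. P p \<Longrightarrow> P q \<Longrightarrow> P (p + q)"
  shows "P p"
proof (induction p rule: update_induct)
  case const
  show ?case using assms(1)[of 0 0] by simp
next
  case (update f a b)
  have "Poly_Mapping.update a b f = f + Poly_Mapping.single a b"
    using update by (intro poly_mapping_eqI)
      (auto simp: lookup_update lookup_add lookup_single in_keys_iff when_def)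
  then show ?case using assms update by simp
qed

definition var :: "'v \<Rightarrow> ('v, 'a::comm_ring_1) mpolynomial"
  where "var v = Poly_Mapping.single (Poly_Mapping.single v 1) 1"

text \<open>
  Up to a scalar, \<open>X\<^sup>t\<close> is the derivative of a single monomial, \<open>X\<^sup>t X\<^sub>v\<close>, and there with the factor \<open>t\<^sub>v + 1\<close>.
\<close>

definition partial :: "'v \<Rightarrow> ('v, 'a::comm_ring_1) mpolynomial \<Rightarrow> ('v, 'a) mpolynomial"
  where "partial v p = Abs_poly_mapping
    (\<lambda>t. of_nat (Suc (Poly_Mapping.lookup t v)) * Poly_Mapping.lookup p (t + Poly_Mapping.single v 1))"

lemma lookup_partial:
  "Poly_Mapping.lookup (partial v p) t =
    of_nat (Suc (Poly_Mapping.lookup t v)) * Poly_Mapping.lookup p (t + Poly_Mapping.single v 1)"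
proof -
  have "finite ((\<lambda>t. t + Poly_Mapping.single v 1) -` Poly_Mapping.keys p)"
    by (intro finite_vimageI) (auto intro: injI)
  then have "finite {t. of_nat (Suc (Poly_Mapping.lookup t v)) *
      Poly_Mapping.lookup p (t + Poly_Mapping.single v 1) \<noteq> 0}"
    by (rule finite_subset[rotated]) (auto simp: in_keys_iff)
  then show ?thesis unfolding partial_def by simp
qed

lemma partial_add: "partial v (p + q) = partial v p + partial v q"
  by (intro poly_mapping_eqI) (simp add: lookup_partial lookup_add algebra_simps)

lemma partial_monomial:
  "partial v (Poly_Mapping.single t a) =
    Poly_Mapping.single (t - Poly_Mapping.single v 1) (of_nat (Poly_Mapping.lookup t v) * a)"
proof (intro poly_mapping_eqI)
  fix s
  show "Poly_Mapping.lookup (partial v (Poly_Mapping.single t a)) s =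
    Poly_Mapping.lookup (Poly_Mapping.single (t - Poly_Mapping.single v 1) (of_nat (Poly_Mapping.lookup t v) * a)) s"
  proof (cases "t = s + Poly_Mapping.single v 1")
    case True
    then show ?thesis by (simp add: lookup_partial lookup_add)
  next
    case False
    have "Poly_Mapping.lookup t v = 0" if "t - Poly_Mapping.single v 1 = s"
    proof (rule ccontr)
      assume *: "Poly_Mapping.lookup t v \<noteq> 0"
      have "t = s + Poly_Mapping.single v 1" using that *
        by (intro poly_mapping_eqI) (auto simp: lookup_add lookup_minus lookup_single when_def)
      with False show False by simp
    qed
    with False show ?thesis by (auto simp: lookup_partial lookup_single when_def)
  qed
qed

lemma partial_mult: "partial v (p * q) = p * partial v q + partial v p * q"
proof (induction p rule: mpolynomial_induct)
  case (monomial t a)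
  show ?case
  proof (induction q rule: mpolynomial_induct)
    case (monomial s b)
    have *: "t + s - Poly_Mapping.single v 1 = t + (s - Poly_Mapping.single v 1)" 
      if "Poly_Mapping.lookup s v \<noteq> 0" for s t :: "'a \<Rightarrow>\<^sub>0 nat"
      using that by (intro poly_mapping_eqI) (auto simp: lookup_add lookup_minus lookup_single when_def)
    have **: "t + s - Poly_Mapping.single v 1 = (t - Poly_Mapping.single v 1) + s"
      if "Poly_Mapping.lookup t v \<noteq> 0"
      using *[OF that, of s] by (simp add: add.commute)
    show ?case
      using *[of s t] **
      by (cases "Poly_Mapping.lookup s v = 0"; cases "Poly_Mapping.lookup t v = 0")
         (auto simp: partial_monomial mult_single lookup_add algebra_simps simp flip: single_add)
  next
    case (add p q)
    then show ?case by (simp add: partial_add algebra_simps)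
  qed
next
  case (add p q)
  then show ?case by (simp add: partial_add algebra_simps)
qed

lemma partial_var: "partial v (var w) = (if v = w then 1 else 0)"
  by (auto simp: var_def partial_monomial lookup_single when_def)

lemma euler_formula:
  fixes p :: "('v::finite, 'a::comm_ring_1) mpolynomial"
  assumes "p \<in> grade poly_graded k"
  shows "(\<Sum>v\<in>UNIV. var v * partial v p) = of_int k * p"
proof -
  have lookup: "Poly_Mapping.lookup (\<Sum>v\<in>UNIV. var v * partial v p) t =
      of_nat (monomial_degree t) * Poly_Mapping.lookup p t" for p :: "('v, 'a) mpolynomial" and t
  proof (induction p rule: mpolynomial_induct)
    case (monomial s a)
    have "var v * partial v (Poly_Mapping.single s a) = Poly_Mapping.single s (of_nat (Poly_Mapping.lookup s v) * a)" for v
    proof (cases "Poly_Mapping.lookup s v = 0")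
      case False
      then have "Poly_Mapping.single v 1 + (s - Poly_Mapping.single v 1) = s"
        by (intro poly_mapping_eqI) (auto simp: lookup_add lookup_minus lookup_single when_def)
      then show ?thesis by (simp add: var_def partial_monomial mult_single)
    qed (simp add: partial_monomial)
    then show ?case
      by (auto simp: lookup_sum lookup_single when_def monomial_degree_def sum_distrib_right)
  next
    case (add p q)
    then show ?case by (simp add: partial_add algebra_simps sum.distrib lookup_add)
  qed
  have deg: "int (monomial_degree t) = k" if "Poly_Mapping.lookup p t \<noteq> 0" for t
    using assms that by (auto simp: poly_graded_def in_keys_iff)
  have const: "Poly_Mapping.lookup (of_int k * p) t = of_int k * Poly_Mapping.lookup p t" for t
    by (simp add: map.rep_eq when_def flip: single_of_int mult_map_scale_conv_mult)
  show ?thesis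
  proof (intro poly_mapping_eqI)
    fix t
    show "Poly_Mapping.lookup (\<Sum>v\<in>UNIV. var v * partial v p) t = Poly_Mapping.lookup (of_int k * p) t"
      using deg[of t] by (cases "Poly_Mapping.lookup p t = 0") (auto simp: lookup const)
  qed
qed

lemma monomial_degree_add: "monomial_degree (s + t) = monomial_degree s + monomial_degree t"
  by (simp add: monomial_degree_def lookup_add sum.distrib)

lemma monomial_degree_single: "monomial_degree (Poly_Mapping.single v (Suc 0)) = 1"
  by (simp add: monomial_degree_def lookup_single when_def)

lemma monomial_homogeneous: "Poly_Mapping.single t a \<in> grade poly_graded (int (monomial_degree t))"
  by (simp add: poly_graded_def)

lemma var_homogeneous: "var v \<in> grade poly_graded 1"
  using monomial_homogeneous[of "Poly_Mapping.single v 1" 1] by (simp add: var_def monomial_degree_single)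

lemma of_int_homogeneous: "of_int n \<in> grade poly_graded 0"
  using monomial_homogeneous[of 0 "of_int n"] by (simp add: monomial_degree_def)

lemma partial_homogeneous:
  assumes "p \<in> grade poly_graded k" shows "partial v p \<in> grade poly_graded (k - 1)"
  unfolding poly_graded_def
proof (simp, intro ballI)
  fix t assume "t \<in> Poly_Mapping.keys (partial v p)"
  then have "t + Poly_Mapping.single v 1 \<in> Poly_Mapping.keys p"
    by (auto simp: in_keys_iff lookup_partial)
  with assms have "int (monomial_degree (t + Poly_Mapping.single v 1)) = k"
    by (auto simp: poly_graded_def)
  then show "int (monomial_degree t) = k - 1"
    by (simp add: monomial_degree_add monomial_degree_single)
qed

definition derivation ::
    "(('v::finite, 'a::comm_ring_1) mpolynomial \<Rightarrow> ('v, 'a) mpolynomial) \<Rightarrow> int \<Rightarrow> bool"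
  where "derivation \<delta> k \<longleftrightarrow>
    (\<forall>p q. \<delta> (p + q) = \<delta> p + \<delta> q) \<and> (\<forall>p q. \<delta> (p * q) = p * \<delta> q + \<delta> p * q) \<and>
    (\<forall>n. \<delta> ` grade poly_graded n \<subseteq> grade poly_graded (n + k))"

lemma derivation_partial: "derivation (partial v) (- 1)"
  using partial_homogeneous by (fastforce simp: derivation_def partial_add partial_mult)

lemma derivationD:
  assumes "derivation \<delta> k"
  shows "\<delta> (p + q) = \<delta> p + \<delta> q" "\<delta> (p * q) = p * \<delta> q + \<delta> p * q"
    "p \<in> grade poly_graded n \<Longrightarrow> \<delta> p \<in> grade poly_graded (n + k)" "\<delta> 1 = 0" "\<delta> 0 = 0"
proof -
  show A: "\<delta> (p + q) = \<delta> p + \<delta> q" "\<delta> (p * q) = p * \<delta> q + \<delta> p * q" for p q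
    using assms by (auto simp: derivation_def)
  show "p \<in> grade poly_graded n \<Longrightarrow> \<delta> p \<in> grade poly_graded (n + k)"
    using assms unfolding derivation_def by blast
  show "\<delta> 1 = 0" "\<delta> 0 = 0" using A(2)[of 1 1] A(1)[of 0 0] by simp_all
qed

text \<open>
  In \<open>\<delta> (a b) = a \<delta> b + \<delta> a b\<close> with \<open>a \<in> I\<^sup>t\<close> and \<open>b \<in> I\<close>, at most one factor from \<open>I\<close> is lost.
\<close>

lemma derivation_ideal_power:
  fixes \<delta> :: "('v::finite, 'a::comm_ring_1) mpolynomial \<Rightarrow> ('v, 'a) mpolynomial"
  assumes "ideal I poly_ring" and "derivation \<delta> k"
    and "p \<in> I [^]\<^bsub>ideals_set poly_ring\<^esub> Suc t"
  shows "\<delta> p \<in> I [^]\<^bsub>ideals_set poly_ring\<^esub> t"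
  using assms(3)
proof (induction t arbitrary: p)
  case 0
  then show ?case by (simp add: nat_pow_def ideals_set_def)
next
  case (Suc t)
  interpret R: cring "poly_ring :: ('v, 'a) mpolynomial ring" by (rule cring_from_type_algebra)
  interpret S: comm_monoid "ideals_set (poly_ring :: ('v, 'a) mpolynomial ring)"
    by (rule R.ideals_set_is_comm_monoid)
  have I: "I \<in> carrier (ideals_set poly_ring)" using assms(1) by (simp add: ideals_set_def)
  have ideal: "ideal (I [^]\<^bsub>ideals_set poly_ring\<^esub> n) poly_ring" for n :: nat
    using S.nat_pow_closed[OF I, of n] by (simp add: ideals_set_def)
  have Suc_eq: "I [^]\<^bsub>ideals_set poly_ring\<^esub> Suc n = ideal_prod poly_ring (I [^]\<^bsub>ideals_set poly_ring\<^esub> n) I" for n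
    by (simp add: ideals_set_def)
  interpret J: ideal "I [^]\<^bsub>ideals_set poly_ring\<^esub> Suc t" poly_ring by (rule ideal)
  from Suc.prems show ?case
    unfolding Suc_eq[of "Suc t"]
  proof (induction p rule: ideal_prod.induct)
    case (prod a b)
    have "\<delta> a * b \<in> I [^]\<^bsub>ideals_set poly_ring\<^esub> Suc t"
      using ideal_prod.prod[OF Suc.IH[OF prod(1)] prod(2), of poly_ring]
      by (subst Suc_eq) simp
    moreover have "a * \<delta> b \<in> I [^]\<^bsub>ideals_set poly_ring\<^esub> Suc t"
      using J.I_r_closed[OF prod(1), of "\<delta> b"] by simp
    ultimately show ?case
      using J.a_closed by (fastforce simp: derivationD[OF assms(2)])
  next
    case (sum a b)
    then show ?case using J.a_closed[of "\<delta> a" "\<delta> b"] by (simp add: derivationD[OF assms(2)])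
  qed
qed

lemma ideal_power_antimono:
  fixes I :: "('v::finite, 'a::comm_ring_1) mpolynomial set"
  assumes "ideal I poly_ring" and "s \<le> t"
  shows "I [^]\<^bsub>ideals_set poly_ring\<^esub> t \<subseteq> I [^]\<^bsub>ideals_set poly_ring\<^esub> (s::nat)"
  using assms(2)
proof (induction t rule: dec_induct)
  case (step n)
  interpret R: cring "poly_ring :: ('v, 'a) mpolynomial ring" by (rule cring_from_type_algebra)
  interpret S: comm_monoid "ideals_set (poly_ring :: ('v, 'a) mpolynomial ring)"
    by (rule R.ideals_set_is_comm_monoid)
  have I: "I \<in> carrier (ideals_set poly_ring)" using assms(1) by (simp add: ideals_set_def)
  have ideal: "ideal (I [^]\<^bsub>ideals_set poly_ring\<^esub> n) poly_ring" for n :: nat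
    using S.nat_pow_closed[OF I, of n] by (simp add: ideals_set_def)
  have "I [^]\<^bsub>ideals_set poly_ring\<^esub> Suc n \<subseteq> I [^]\<^bsub>ideals_set poly_ring\<^esub> n"
    using R.ideal_prod_inter[OF ideal assms(1), of n] by (auto simp: ideals_set_def)
  with step show ?case by blast
qed auto

section \<open>Homogeneous components\<close>

lemma (in abelian_group) minus_add_cancel_right:
  assumes "x \<in> carrier G" "y \<in> carrier G" "z \<in> carrier G"
  shows "(x \<oplus> z) \<ominus> (y \<oplus> z) = x \<ominus> y"
  using assms a_comm[of "\<ominus> y" "\<ominus> z"] by (simp add: minus_eq minus_add a_assoc r_neg2)

lemma additive_map_finsum:
  assumes "abelian_group M" "abelian_group N" "h \<in> carrier M \<rightarrow> carrier N"
    and add: "\<And>x y. x \<in> carrier M \<Longrightarrow> y \<in> carrier M \<Longrightarrow> h (x \<oplus>\<^bsub>M\<^esub> y) = h x \<oplus>\<^bsub>N\<^esub> h y"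
  shows "h \<zero>\<^bsub>M\<^esub> = \<zero>\<^bsub>N\<^esub>"
    and "finite S \<Longrightarrow> c \<in> S \<rightarrow> carrier M \<Longrightarrow> h (finsum M c S) = finsum N (\<lambda>n. h (c n)) S"
proof -
  interpret M: abelian_group M by fact
  interpret N: abelian_group N by fact
  have "h \<zero>\<^bsub>M\<^esub> \<oplus>\<^bsub>N\<^esub> h \<zero>\<^bsub>M\<^esub> = h \<zero>\<^bsub>M\<^esub>"
    using add[of "\<zero>\<^bsub>M\<^esub>" "\<zero>\<^bsub>M\<^esub>"] by simp
  moreover have "h \<zero>\<^bsub>M\<^esub> \<in> carrier N" using assms(3) by blast
  ultimately show zero: "h \<zero>\<^bsub>M\<^esub> = \<zero>\<^bsub>N\<^esub>" using N.add.l_cancel_one by blast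
  show "h (finsum M c S) = finsum N (\<lambda>n. h (c n)) S" if "finite S" "c \<in> S \<rightarrow> carrier M"
    using that
  proof (induction S)
    case empty
    then show ?case by (simp add: zero)
  next
    case (insert a S)
    then have "(\<lambda>n. h (c n)) \<in> S \<rightarrow> carrier N" "h (c a) \<in> carrier N" using assms(3) by auto
    with insert show ?case by (simp add: add M.finsum_closed)
  qed
qed

definition component ::
    "(('v::finite, 'a::comm_ring_1) mpolynomial, 'b, 'c) graded_module_scheme \<Rightarrow> int \<Rightarrow> 'b \<Rightarrow> 'b"
  where "component M n x = (THE c. (\<forall>n. c n \<in> grade M n) \<and> finite {n. c n \<noteq> \<zero>\<^bsub>M\<^esub>} \<and>
           x = finsum M c {n. c n \<noteq> \<zero>\<^bsub>M\<^esub>}) n"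

context graded_module
begin

sublocale grade: additive_subgroup "grade M n" M for n
  by (rule grade_subgroup)

lemma grade_carrier: "x \<in> grade M n \<Longrightarrow> x \<in> carrier M"
  using grade.a_subset by blast

text \<open>
  The summation set may be any finite set that contains the support. This is what makes sums of two
  decompositions with different supports comparable.
\<close>

lemma component_eqI:
  assumes "\<And>n. c n \<in> grade M n" "finite S" "\<And>n. n \<notin> S \<Longrightarrow> c n = \<zero>" "x = finsum M c S"
  shows "component M n x = c n"
proof -
  let ?P = "\<lambda>c. (\<forall>n. c n \<in> grade M n) \<and> finite {n. c n \<noteq> \<zero>} \<and> x = finsum M c {n. c n \<noteq> \<zero>}"
  have c: "c n \<in> carrier M" for n using assms(1) grade_carrier by blast
  have sub: "{n. c n \<noteq> \<zero>} \<subseteq> S" using assms(3) by blast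
  then have "finite {n. c n \<noteq> \<zero>}" using assms(2) finite_subset by blast
  moreover have "finsum M c {n. c n \<noteq> \<zero>} = finsum M c S"
    using assms(2) sub c by (intro M.add.finprod_mono_neutral_cong_left) auto
  ultimately have P: "?P c" using assms by simp
  moreover have "x \<in> carrier M" using assms(4) c by (auto intro: M.finsum_closed)
  ultimately have "(THE c. ?P c) = c"
    using grade_direct_sum[of x] by (intro the1_equality) auto
  then show ?thesis by (simp add: component_def)
qed

lemma component_props:
  assumes "x \<in> carrier M"
  shows "component M n x \<in> grade M n" "finite {n. component M n x \<noteq> \<zero>}"
    "finsum M (\<lambda>n. component M n x) {n. component M n x \<noteq> \<zero>} = x"
proof -
  let ?P = "\<lambda>c. (\<forall>n. c n \<in> grade M n) \<and> finite {n. c n \<noteq> \<zero>} \<and> x = finsum M c {n. c n \<noteq> \<zero>}"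
  have "?P (THE c. ?P c)" using grade_direct_sum[OF assms] by (rule theI')
  moreover have "(\<lambda>n. component M n x) = (THE c. ?P c)" by (simp add: component_def)
  ultimately show "component M n x \<in> grade M n" "finite {n. component M n x \<noteq> \<zero>}"
    "finsum M (\<lambda>n. component M n x) {n. component M n x \<noteq> \<zero>} = x"
    by (simp_all add: component_def)
qed

lemma component_closed [simp]: "x \<in> carrier M \<Longrightarrow> component M n x \<in> carrier M"
  using component_props(1) grade_carrier by blast

lemma component_homogeneous:
  assumes "x \<in> grade M n"
  shows "component M k x = (if k = n then x else \<zero>)"
  by (rule component_eqI[where S = "{n}"]) (use assms grade_carrier in \<open>auto simp: grade.zero_closed\<close>)

lemma component_add:
  assumes "x \<in> carrier M" "y \<in> carrier M"
  shows "component M n (x \<oplus> y) = component M n x \<oplus> component M n y"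
proof (rule component_eqI[where S = "{n. component M n x \<noteq> \<zero>} \<union> {n. component M n y \<noteq> \<zero>}"])
  let ?S = "{n. component M n x \<noteq> \<zero>} \<union> {n. component M n y \<noteq> \<zero>}"
  have fin: "finite ?S" using component_props(2) assms by blast
  have sum: "finsum M (\<lambda>n. component M n z) ?S = z"
    if "z \<in> carrier M" "{n. component M n z \<noteq> \<zero>} \<subseteq> ?S" for z
  proof -
    have "finsum M (\<lambda>n. component M n z) {n. component M n z \<noteq> \<zero>} = finsum M (\<lambda>n. component M n z) ?S"
      using fin that by (intro M.add.finprod_mono_neutral_cong_left) auto
    then show ?thesis using component_props(3)[OF that(1)] by simp
  qed
  have "finsum M (\<lambda>n. component M n x) ?S = x" "finsum M (\<lambda>n. component M n y) ?S = y"
    using assms by (intro sum; blast)+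
  moreover have "finsum M (\<lambda>n. component M n x \<oplus> component M n y) ?S =
      finsum M (\<lambda>n. component M n x) ?S \<oplus> finsum M (\<lambda>n. component M n y) ?S"
    using assms by (intro M.finsum_addf) auto
  ultimately show "x \<oplus> y = finsum M (\<lambda>n. component M n x \<oplus> component M n y) ?S" by simp
qed (use assms in \<open>auto intro: component_props(1) grade.a_closed component_props(2)\<close>)

lemma homogeneous_induct [consumes 1, case_names homogeneous add]:
  assumes "x \<in> carrier M"
    and hom: "\<And>n x. x \<in> grade M n \<Longrightarrow> P x"
    and add: "\<And>x y. \<lbrakk> x \<in> carrier M; y \<in> carrier M; P x; P y \<rbrakk> \<Longrightarrow> P (x \<oplus> y)"
  shows "P x"
proof -
  have "P (finsum M (\<lambda>n. component M n x) S)" if "finite S" for S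
    using that
  proof induction
    case empty
    then show ?case using hom[OF grade.zero_closed] by simp
  next
    case (insert a S)
    then show ?case using assms(1)
      by (auto simp: M.finsum_closed intro!: add M.finsum_closed intro: hom component_props(1))
  qed
  from this[OF component_props(2)[OF assms(1)]] show ?thesis
    using component_props(3)[OF assms(1)] by simp
qed

end

text \<open>
  A direct sum decomposition amounts to its system of projections: these recover the summands of any
  decomposition, which gives uniqueness, and the sum of all projections of \<open>x\<close> has the same projections
  as \<open>x\<close>, hence equals \<open>x\<close> when the projections are jointly injective. In this form the grading of
  submodules and extensions can be checked without manipulating finite sums.
\<close>

lemma graded_moduleI:
  fixes M :: "(('v::finite, 'a::comm_ring_1) mpolynomial, 'b, 'c) graded_module_scheme" (structure)
  assumes "module poly_ring M"
    and "\<And>n. additive_subgroup (grade M n) M"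
    and "\<And>p k x n. p \<in> grade poly_graded k \<Longrightarrow> x \<in> grade M n \<Longrightarrow> p \<odot> x \<in> grade M (k + n)"
    and p_grade: "\<And>n x. x \<in> carrier M \<Longrightarrow> p n x \<in> grade M n"
    and p_add: "\<And>n x y. x \<in> carrier M \<Longrightarrow> y \<in> carrier M \<Longrightarrow> p n (x \<oplus> y) = p n x \<oplus> p n y"
    and p_hom: "\<And>n k x. x \<in> grade M n \<Longrightarrow> p k x = (if k = n then x else \<zero>)"
    and p_fin: "\<And>x. x \<in> carrier M \<Longrightarrow> finite {n. p n x \<noteq> \<zero>}"
    and p_inj: "\<And>x. x \<in> carrier M \<Longrightarrow> (\<And>n. p n x = \<zero>) \<Longrightarrow> x = \<zero>"
  shows "graded_module M"
proof -
  interpret module poly_ring M by fact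
  interpret grade: additive_subgroup "grade M n" M for n by fact
  have carr: "x \<in> grade M n \<Longrightarrow> x \<in> carrier M" for x n using grade.a_subset by blast
  have p_closed: "p n \<in> carrier M \<rightarrow> carrier M" for n using p_grade carr by blast
  note p_sum = additive_map_finsum[OF M.abelian_group_axioms M.abelian_group_axioms p_closed p_add]
  have p_recover: "p n (finsum M c S) = c n"
    if c: "\<And>n. c n \<in> grade M n" and S: "finite S" "\<And>n. n \<notin> S \<Longrightarrow> c n = \<zero>" for c S n
  proof -
    have "p n (finsum M c S) = finsum M (\<lambda>k. p n (c k)) S"
      using carr[OF c] S(1) by (intro p_sum(2)) auto
    also have "\<dots> = finsum M (\<lambda>k. if n = k then c k else \<zero>) S"
      using carr[OF c] by (intro M.finsum_cong) (auto simp: simp_implies_def p_hom[OF c])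
    also have "\<dots> = (if n \<in> S then c n else \<zero>)"
    proof (cases "n \<in> S")
      case True
      then show ?thesis using M.finsum_singleton[OF True S(1), of c] carr[OF c] by auto
    next
      case False
      then have "finsum M (\<lambda>k. if n = k then c k else \<zero>) S = finsum M (\<lambda>k. \<zero>) S"
        by (intro M.finsum_cong') auto
      then show ?thesis using False by simp
    qed
    also have "\<dots> = c n" using S(2) by auto
    finally show ?thesis .
  qed
  show ?thesis
  proof (unfold_locales, goal_cases)
    case (1 p k x n) then show ?case using assms(3) by blast
  next
    case (2 x)
    define y where "y = finsum M (\<lambda>n. p n x) {n. p n x \<noteq> \<zero>}"
    have y: "y \<in> carrier M"
      unfolding y_def using p_closed 2 by (intro M.finsum_closed) auto
    have py: "p n y = p n x" for n
      unfolding y_def using 2 p_grade p_fin by (intro p_recover) auto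
    have cancel: "(x \<ominus> y) \<oplus> y = x" using 2 y by (simp add: M.minus_eq M.a_assoc M.l_neg)
    have "p n (x \<ominus> y) = \<zero>" for n
    proof -
      have "p n ((x \<ominus> y) \<oplus> y) = p n (x \<ominus> y) \<oplus> p n y" using 2 y by (intro p_add) auto
      then have "p n x = p n (x \<ominus> y) \<oplus> p n x" by (simp add: py cancel)
      moreover have "p n x \<in> carrier M" "p n (x \<ominus> y) \<in> carrier M"
        using p_closed[of n] 2 y M.minus_closed[OF 2 y] by blast+
      ultimately show ?thesis by (metis M.add.r_cancel_one')
    qed
    then have "x \<ominus> y = \<zero>" using 2 y p_inj by auto
    then have "x = y" using 2 y by (metis M.l_zero cancel)
    show ?case
    proof (rule ex1I[of _ "\<lambda>n. p n x"])
      show "(\<forall>n. p n x \<in> grade M n) \<and> finite {n. p n x \<noteq> \<zero>} \<and>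
        x = finsum M (\<lambda>n. p n x) {n. p n x \<noteq> \<zero>}"
        using p_grade[OF 2] p_fin[OF 2] \<open>x = y\<close> unfolding y_def by blast
    next
      fix c assume c: "(\<forall>n. c n \<in> grade M n) \<and> finite {n. c n \<noteq> \<zero>} \<and> x = finsum M c {n. c n \<noteq> \<zero>}"
      have "p n (finsum M c {n. c n \<noteq> \<zero>}) = c n" for n using c by (intro p_recover) blast+
      then show "c = (\<lambda>n. p n x)" using c by (intro ext) metis
    qed
  qed
qed

lemma graded_homD:
  assumes "h \<in> graded_hom M N"
  shows "x \<in> carrier M \<Longrightarrow> h x \<in> carrier N"
    "x \<in> carrier M \<Longrightarrow> y \<in> carrier M \<Longrightarrow> h (x \<oplus>\<^bsub>M\<^esub> y) = h x \<oplus>\<^bsub>N\<^esub> h y"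
    "x \<in> carrier M \<Longrightarrow> h (p \<odot>\<^bsub>M\<^esub> x) = p \<odot>\<^bsub>N\<^esub> h x"
    "x \<in> grade M n \<Longrightarrow> h x \<in> grade N n"
  using assms unfolding graded_hom_def by blast+

lemma graded_hom_zero:
  assumes "graded_module M" "graded_module N" "h \<in> graded_hom M N"
  shows "h \<zero>\<^bsub>M\<^esub> = \<zero>\<^bsub>N\<^esub>"
proof -
  interpret M: graded_module M by fact
  interpret N: graded_module N by fact
  show ?thesis
    using additive_map_finsum(1)[OF M.M.abelian_group_axioms N.M.abelian_group_axioms] graded_homD[OF assms(3)]
    by blast
qed

lemma graded_hom_component:
  assumes "graded_module M" "graded_module N" "h \<in> graded_hom M N" "x \<in> carrier M"
  shows "h (component M n x) = component N n (h x)"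
proof -
  interpret M: graded_module M by fact
  interpret N: graded_module N by fact
  from assms(4) show ?thesis
  proof (induction x rule: M.homogeneous_induct)
    case (homogeneous k x)
    then show ?case
      using graded_homD[OF assms(3)] graded_hom_zero[OF assms(1-3)]
      by (auto simp: M.component_homogeneous[OF homogeneous] N.component_homogeneous[OF graded_homD(4)[OF assms(3) homogeneous]])
  next
    case (add x y)
    then show ?case
      by (simp add: graded_homD[OF assms(3)] M.component_add N.component_add)
  qed
qed

lemma poly_graded_simps [simp]:
  "carrier poly_graded = UNIV" "\<zero>\<^bsub>poly_graded\<^esub> = 0" "x \<oplus>\<^bsub>poly_graded\<^esub> y = x + y" "p \<odot>\<^bsub>poly_graded\<^esub> x = p * x"
  by (simp_all add: poly_graded_def)

lemma homogeneous_mult: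
  assumes "p \<in> grade poly_graded k" "q \<in> grade poly_graded n"
  shows "p * q \<in> grade poly_graded (k + n)"
proof -
  have "int (monomial_degree t) = k + n" if "t \<in> Poly_Mapping.keys (p * q)" for t
  proof -
    from that keys_mult[of p q] obtain r s where "t = r + s" "r \<in> Poly_Mapping.keys p" "s \<in> Poly_Mapping.keys q"
      by blast
    then show ?thesis using assms by (simp add: poly_graded_def monomial_degree_add)
  qed
  then show ?thesis by (simp add: poly_graded_def)
qed

lemma poly_graded_abelian_group: "abelian_group poly_graded"
  by (rule abelian_groupI) (auto simp: algebra_simps intro: exI[of _ "- _"])

lemma poly_graded_module: "graded_module (poly_graded :: (('v::finite, 'a::comm_ring_1) mpolynomial, _) graded_module)"
proof -
  define c :: "int \<Rightarrow> ('v, 'a) mpolynomial \<Rightarrow> ('v, 'a) mpolynomial" where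
    "c = (\<lambda>n p. Poly_Mapping.mapp (\<lambda>t a. a when int (monomial_degree t) = n) p)"
  have lookup_c: "Poly_Mapping.lookup (c n p) t = (Poly_Mapping.lookup p t when int (monomial_degree t) = n)" for n p t
    by (auto simp: c_def lookup_mapp when_def in_keys_iff)
  show ?thesis
  proof (rule graded_moduleI[where p = c], goal_cases)
    case 1
    show ?case
      by (rule moduleI[OF cring_from_type_algebra poly_graded_abelian_group]) (auto simp: algebra_simps)
  next
    case (2 n)
    interpret abelian_group "poly_graded :: (('v, 'a) mpolynomial, _) graded_module"
      by (rule poly_graded_abelian_group)
    have inv: "\<ominus>\<^bsub>poly_graded\<^esub> p = - p" for p :: "('v, 'a) mpolynomial"
      by (rule minus_equality) auto
    have iff: "p \<in> grade poly_graded n \<longleftrightarrow> (\<forall>t. int (monomial_degree t) \<noteq> n \<longrightarrow> Poly_Mapping.lookup p t = 0)"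
      for p :: "('v, 'a) mpolynomial" by (auto simp: poly_graded_def in_keys_iff)
    have "subgroup (grade (poly_graded :: (('v, 'a) mpolynomial, _) graded_module) n) (add_monoid poly_graded)"
    proof (rule add.subgroupI)
      have "0 \<in> grade (poly_graded :: (('v, 'a) mpolynomial, _) graded_module) n" by (simp add: iff)
      then show "grade (poly_graded :: (('v, 'a) mpolynomial, _) graded_module) n \<noteq> {}" by blast
    qed (simp_all add: inv iff lookup_add)
    then show ?case by (rule additive_subgroup.intro)
  next
    case (3 p k x n)
    then show ?case by (simp add: homogeneous_mult)
  next
    case (4 n x)
    then show ?case by (auto simp: poly_graded_def in_keys_iff lookup_c when_def split: if_splits)
  next
    case (5 n x y)
    then show ?case by (auto intro!: poly_mapping_eqI simp: lookup_c lookup_add when_def)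
  next
    case (6 n k x)
    have "Poly_Mapping.lookup x t = 0" if "int (monomial_degree t) \<noteq> n" for t
      using 6 that by (auto simp: poly_graded_def in_keys_iff)
    then show ?case by (auto intro!: poly_mapping_eqI simp: lookup_c when_def)
  next
    case (7 x)
    have "{n. c n x \<noteq> 0} \<subseteq> (\<lambda>t. int (monomial_degree t)) ` Poly_Mapping.keys x"
    proof
      fix n assume "n \<in> {n. c n x \<noteq> 0}"
      then obtain t where "Poly_Mapping.lookup (c n x) t \<noteq> 0"
        by (metis (mono_tags) lookup_zero mem_Collect_eq poly_mapping_eqI)
      then show "n \<in> (\<lambda>t. int (monomial_degree t)) ` Poly_Mapping.keys x"
        by (auto simp: lookup_c when_def in_keys_iff split: if_splits)
    qed
    then show ?case using finite_subset by fastforce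
  next
    case (8 x)
    have "Poly_Mapping.lookup x t = 0" for t
      using 8(2)[of "int (monomial_degree t)"] lookup_c[of "int (monomial_degree t)" x t] by simp
    then show ?case by (auto intro: poly_mapping_eqI)
  qed
qed

section \<open>Extending homomorphisms into injective modules\<close>

text \<open>
  Graded injectivity of \<open>E\<close> is tested on modules whose elements have the same type as those of \<open>E\<close>.
  Modules over another type are brought into that type along an injection \<open>\<pi>\<close>.
\<close>

definition transport ::
    "('f \<Rightarrow> 'e) \<Rightarrow> (('v::finite, 'a::comm_ring_1) mpolynomial, 'f) graded_module \<Rightarrow>
     (('v, 'a) mpolynomial, 'e) graded_module"
  where "transport \<pi> M =
    \<lparr> carrier = \<pi> ` carrier M, monoid.mult = undefined, one = undefined, ring.zero = \<pi> \<zero>\<^bsub>M\<^esub>,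
      add = (\<lambda>a b. \<pi> (the_inv \<pi> a \<oplus>\<^bsub>M\<^esub> the_inv \<pi> b)), module.smult = (\<lambda>p a. \<pi> (p \<odot>\<^bsub>M\<^esub> the_inv \<pi> a)),
      grade = (\<lambda>n. \<pi> ` grade M n) \<rparr>"

lemma transport_simps [simp]:
  assumes "inj \<pi>"
  shows "carrier (transport \<pi> M) = \<pi> ` carrier M" "\<zero>\<^bsub>transport \<pi> M\<^esub> = \<pi> \<zero>\<^bsub>M\<^esub>"
    "\<pi> x \<oplus>\<^bsub>transport \<pi> M\<^esub> \<pi> y = \<pi> (x \<oplus>\<^bsub>M\<^esub> y)" "p \<odot>\<^bsub>transport \<pi> M\<^esub> \<pi> x = \<pi> (p \<odot>\<^bsub>M\<^esub> x)"
    "grade (transport \<pi> M) n = \<pi> ` grade M n"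
  using assms by (simp_all add: transport_def the_inv_f_f)

lemma additive_subgroup_left_inverseI:
  assumes "abelian_group M" "H \<subseteq> carrier M" "\<zero>\<^bsub>M\<^esub> \<in> H"
    "\<And>x y. x \<in> H \<Longrightarrow> y \<in> H \<Longrightarrow> x \<oplus>\<^bsub>M\<^esub> y \<in> H" "\<And>x. x \<in> H \<Longrightarrow> \<exists>y\<in>H. y \<oplus>\<^bsub>M\<^esub> x = \<zero>\<^bsub>M\<^esub>"
  shows "additive_subgroup H M"
proof -
  interpret abelian_group M by fact
  have "\<ominus>\<^bsub>M\<^esub> x \<in> H" if "x \<in> H" for x
    using assms(5)[OF that] that assms(2) minus_equality by (metis subsetD)
  then show ?thesis
    using assms by (intro additive_subgroup.intro add.subgroupI) (auto simp: a_inv_def)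
qed

context graded_module
begin

lemma scalar_simps [simp]:
  "x \<in> carrier M \<Longrightarrow> p \<odot> x \<in> carrier M"
  "x \<in> carrier M \<Longrightarrow> 1 \<odot> x = x" "x \<in> carrier M \<Longrightarrow> 0 \<odot> x = \<zero>" "p \<odot> \<zero> = \<zero>"
  using smult_one smult_l_null by simp_all

lemma scalar_distribs:
  "x \<in> carrier M \<Longrightarrow> (p + q) \<odot> x = p \<odot> x \<oplus> q \<odot> x"
  "x \<in> carrier M \<Longrightarrow> (p * q) \<odot> x = p \<odot> (q \<odot> x)"
  "x \<in> carrier M \<Longrightarrow> y \<in> carrier M \<Longrightarrow> p \<odot> (x \<oplus> y) = p \<odot> x \<oplus> p \<odot> y"
  using smult_l_distr[of p q x] smult_assoc1[of p q x] smult_r_distr[of p x y] by simp_all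

lemma component_inject_zero: "\<lbrakk> x \<in> carrier M; \<And>n. component M n x = \<zero> \<rbrakk> \<Longrightarrow> x = \<zero>"
  using component_props(3)[of x] by simp

lemma minus_eq_scalar: "x \<in> carrier M \<Longrightarrow> \<ominus> x = (- 1) \<odot> x"
  using scalar_distribs(1)[of x "- 1" 1] by (intro M.minus_equality) auto

end

lemma graded_module_transport:
  assumes "graded_module M" "inj \<pi>"
  shows "graded_module (transport \<pi> M)"
proof -
  interpret graded_module M by fact
  note [simp] = transport_simps[OF assms(2)] inj_image_mem_iff[OF assms(2)] inj_eq[OF assms(2)]
    the_inv_f_f[OF assms(2)]
  have ag: "abelian_group (transport \<pi> M)"
    by (rule abelian_groupI) (auto simp: M.a_ac intro: M.l_neg M.a_inv_closed)
  show ?thesis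
  proof (rule graded_moduleI[where p = "\<lambda>n a. \<pi> (component M n (the_inv \<pi> a))"], goal_cases)
    case 1
    show ?case
      by (rule moduleI[OF cring_from_type_algebra ag])
        (auto simp: scalar_distribs)
  next
    case (2 n)
    show ?case
      by (rule additive_subgroup_left_inverseI[OF ag])
        (auto simp: grade_carrier grade.a_closed grade.zero_closed intro!: bexI[of _ "\<ominus>\<^bsub>M\<^esub> _"] M.l_neg grade.a_inv_closed)
  next
    case (8 a)
    then obtain x where "a = \<pi> x" "x \<in> carrier M" by auto
    with 8(2) show ?case using component_inject_zero[of x] by simp
  qed (auto simp: grade_smult component_props component_add component_homogeneous component_props(2))
qed

lemma graded_injective_extend:
  fixes L M :: "(('v::finite, 'a::comm_ring_1) mpolynomial, 'f) graded_module"
    and E :: "(('v, 'a) mpolynomial, 'e) graded_module" and \<pi> :: "'f \<Rightarrow> 'e"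
  assumes "graded_injective E" "inj \<pi>" "graded_module L" "graded_module M"
    and j: "j \<in> graded_hom L M" "inj_on j (carrier L)" and f: "f \<in> graded_hom L E"
  shows "\<exists>g\<in>graded_hom M E. \<forall>x\<in>carrier L. g (j x) = f x"
proof -
  note [simp] = transport_simps[OF assms(2)] inj_eq[OF assms(2)] the_inv_f_f[OF assms(2)]
  let ?j = "\<lambda>a. \<pi> (j (the_inv \<pi> a))" and ?f = "\<lambda>a. f (the_inv \<pi> a)"
  have "?j \<in> graded_hom (transport \<pi> L) (transport \<pi> M)"
    unfolding graded_hom_def using graded_homD[OF j(1)] by auto
  moreover have "?f \<in> graded_hom (transport \<pi> L) E"
    unfolding graded_hom_def using graded_homD[OF f] by auto
  moreover have "inj_on ?j (carrier (transport \<pi> L))"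
    using j(2) by (auto simp: inj_on_def)
  moreover note graded_module_transport[OF assms(3,2)] graded_module_transport[OF assms(4,2)]
  ultimately have "\<exists>g\<in>graded_hom (transport \<pi> M) E. \<forall>a\<in>carrier (transport \<pi> L). g (?j a) = ?f a"
    using assms(1)[unfolded graded_injective_def, THEN conjunct2, THEN spec, THEN spec, THEN bspec, THEN bspec, THEN mp]
    by blast
  then obtain g where g: "g \<in> graded_hom (transport \<pi> M) E"
    "\<And>a. a \<in> carrier (transport \<pi> L) \<Longrightarrow> g (?j a) = ?f a" by blast
  have hom: "(\<lambda>x. g (\<pi> x)) \<in> graded_hom M E"
    using g(1) graded_homD[OF g(1)]
    unfolding graded_hom_def by (auto simp flip: transport_simps(3,4)[OF assms(2)])
  have eq: "g (\<pi> (j x)) = f x" if "x \<in> carrier L" for x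
    using g(2)[of "\<pi> x"] that by simp
  show ?thesis by (intro bexI[OF _ hom] ballI eq)
qed

definition graded_submodule ::
    "'b set \<Rightarrow> (('v::finite, 'a::comm_ring_1) mpolynomial, 'b, 'c) graded_module_scheme \<Rightarrow> bool"
  where "graded_submodule N M \<longleftrightarrow> N \<subseteq> carrier M \<and> \<zero>\<^bsub>M\<^esub> \<in> N \<and>
    (\<forall>x\<in>N. \<forall>y\<in>N. x \<oplus>\<^bsub>M\<^esub> y \<in> N) \<and> (\<forall>p. \<forall>x\<in>N. p \<odot>\<^bsub>M\<^esub> x \<in> N) \<and> (\<forall>n. \<forall>x\<in>N. component M n x \<in> N)"

lemma graded_submoduleD:
  assumes "graded_module M" "graded_submodule N M"
  shows "x \<in> N \<Longrightarrow> x \<in> carrier M" "\<zero>\<^bsub>M\<^esub> \<in> N" "x \<in> N \<Longrightarrow> y \<in> N \<Longrightarrow> x \<oplus>\<^bsub>M\<^esub> y \<in> N"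
    "x \<in> N \<Longrightarrow> p \<odot>\<^bsub>M\<^esub> x \<in> N" "x \<in> N \<Longrightarrow> component M n x \<in> N" "x \<in> N \<Longrightarrow> \<ominus>\<^bsub>M\<^esub> x \<in> N"
proof -
  interpret graded_module M by fact
  show N: "x \<in> N \<Longrightarrow> x \<in> carrier M" "\<zero>\<^bsub>M\<^esub> \<in> N" "x \<in> N \<Longrightarrow> y \<in> N \<Longrightarrow> x \<oplus>\<^bsub>M\<^esub> y \<in> N"
    "x \<in> N \<Longrightarrow> p \<odot>\<^bsub>M\<^esub> x \<in> N" "x \<in> N \<Longrightarrow> component M n x \<in> N" for x y p n
    using assms(2) unfolding graded_submodule_def by blast+
  show "x \<in> N \<Longrightarrow> \<ominus>\<^bsub>M\<^esub> x \<in> N" using N(1,4) minus_eq_scalar by simp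
qed

lemma graded_submodule_carrier: "graded_module M \<Longrightarrow> graded_submodule (carrier M) M"
proof -
  assume "graded_module M"
  then interpret graded_module M .
  show ?thesis by (simp add: graded_submodule_def)
qed

lemma graded_submodule_image:
  assumes "graded_module P" "graded_module M" "g \<in> graded_hom P M"
  shows "graded_submodule (g ` carrier P) M"
proof -
  interpret P: graded_module P by fact
  interpret M: graded_module M by fact
  note g = graded_homD[OF assms(3)] graded_hom_zero[OF assms] graded_hom_component[OF assms]
  show ?thesis
    unfolding graded_submodule_def
    by (auto simp: g simp flip: g(2,3,5,6) intro!: imageI)
qed

definition submodule_of ::
    "'b set \<Rightarrow> (('v::finite, 'a::comm_ring_1) mpolynomial, 'b) graded_module \<Rightarrow>
     (('v, 'a) mpolynomial, 'b) graded_module"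
  where "submodule_of N M = M \<lparr> carrier := N, grade := (\<lambda>n. grade M n \<inter> N) \<rparr>"

lemma graded_module_submodule_of:
  assumes "graded_module M" "graded_submodule N M"
  shows "graded_module (submodule_of N M)"
proof -
  interpret graded_module M by fact
  note N = graded_submoduleD[OF assms(1,2)]
  have ag: "abelian_group (submodule_of N M)"
  proof (rule abelian_groupI, goal_cases)
    case (6 x)
    then show ?case
      by (intro bexI[of _ "\<ominus>\<^bsub>M\<^esub> x"]) (auto simp: submodule_of_def N M.l_neg)
  qed (auto simp: submodule_of_def N M.a_ac)
  show ?thesis
  proof (rule graded_moduleI[where p = "component M"], goal_cases)
    case 1
    show ?case
      by (rule moduleI[OF cring_from_type_algebra ag]) (auto simp: submodule_of_def N scalar_distribs)
  next
    case (2 n)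
    show ?case
    proof (rule additive_subgroup_left_inverseI[OF ag], goal_cases)
      case (4 x)
      then show ?case
        by (intro bexI[of _ "\<ominus>\<^bsub>M\<^esub> x"]) (auto simp: submodule_of_def N M.l_neg grade.a_inv_closed)
    qed (auto simp: submodule_of_def N grade.a_closed grade.zero_closed)
  next
    case (8 x)
    then show ?case using component_inject_zero[of x] by (simp add: submodule_of_def N)
  next
    case (4 n x)
    then show ?case using component_props(1)[of x n] by (simp add: submodule_of_def N)
  qed (auto simp: submodule_of_def N grade_smult component_add component_homogeneous component_props(2))
qed

section \<open>Derivations and connections\<close>

text \<open>
  The module \<open>N \<oplus> M\<close> with \<open>p (x, y) = (p x, p y + \<delta> p x)\<close>, an extension of \<open>N\<close> by \<open>M\<close> that splits
  exactly when there is a connection over \<open>\<delta>\<close> from \<open>N\<close> to \<open>M\<close>. The first summand is shifted by \<open>k\<close>, so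
  that the inclusion of \<open>M\<close>, and its retractions, have degree 0 although connections have degree \<open>k\<close>.
\<close>

definition derivation_extension ::
    "(('v::finite, 'a::comm_ring_1) mpolynomial \<Rightarrow> ('v, 'a) mpolynomial) \<Rightarrow> int \<Rightarrow> 'b set \<Rightarrow>
     (('v, 'a) mpolynomial, 'b) graded_module \<Rightarrow> (('v, 'a) mpolynomial, 'b \<times> 'b) graded_module"
  where "derivation_extension \<delta> k N M =
    \<lparr> carrier = N \<times> carrier M, monoid.mult = undefined, one = undefined,
      ring.zero = (\<zero>\<^bsub>M\<^esub>, \<zero>\<^bsub>M\<^esub>),
      add = (\<lambda>a b. (fst a \<oplus>\<^bsub>M\<^esub> fst b, snd a \<oplus>\<^bsub>M\<^esub> snd b)),
      module.smult = (\<lambda>p a. (p \<odot>\<^bsub>M\<^esub> fst a, p \<odot>\<^bsub>M\<^esub> snd a \<oplus>\<^bsub>M\<^esub> \<delta> p \<odot>\<^bsub>M\<^esub> fst a)),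
      grade = (\<lambda>n. (grade M (n - k) \<inter> N) \<times> grade M n) \<rparr>"

lemma graded_module_derivation_extension:
  assumes "graded_module M" "graded_submodule N M" "derivation \<delta> k"
  shows "graded_module (derivation_extension \<delta> k N M)"
proof -
  interpret graded_module M by fact
  note N = graded_submoduleD[OF assms(1,2)]
  let ?X = "derivation_extension \<delta> k N M"
  note simps = derivation_extension_def N
  have ag: "abelian_group ?X"
  proof (rule abelian_groupI, goal_cases)
    case (6 a)
    then show ?case
      by (intro bexI[of _ "(\<ominus>\<^bsub>M\<^esub> fst a, \<ominus>\<^bsub>M\<^esub> snd a)"]) (auto simp: simps M.l_neg)
  qed (auto simp: simps M.a_ac)
  show ?thesis
  proof (rule graded_moduleI[where p = "\<lambda>n a. (component M (n - k) (fst a), component M n (snd a))"], goal_cases)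
    case 1
    show ?case
      by (rule moduleI[OF cring_from_type_algebra ag])
        (auto simp: simps scalar_distribs derivationD[OF assms(3)] M.a_ac)
  next
    case (2 n)
    show ?case
    proof (rule additive_subgroup_left_inverseI[OF ag], goal_cases)
      case (4 a)
      then show ?case
        by (intro bexI[of _ "(\<ominus>\<^bsub>M\<^esub> fst a, \<ominus>\<^bsub>M\<^esub> snd a)"])
          (auto simp: simps grade_carrier M.l_neg grade.a_inv_closed)
    qed (auto simp: simps grade_carrier grade.a_closed grade.zero_closed)
  next
    case (3 p l a n)
    then have "p \<odot>\<^bsub>M\<^esub> fst a \<in> grade M (l + (n - k))" "p \<odot>\<^bsub>M\<^esub> snd a \<in> grade M (l + n)"
      using grade_smult by (auto simp: simps)
    moreover have "\<delta> p \<odot>\<^bsub>M\<^esub> fst a \<in> grade M (l + k + (n - k))"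
      using 3 by (intro grade_smult derivationD(3)[OF assms(3)]) (auto simp: simps)
    ultimately show ?case using 3 by (auto simp: simps algebra_simps intro: grade.a_closed)
  next
    case (7 a)
    have "finite {n. component M (n - k) (fst a) \<noteq> \<zero>\<^bsub>M\<^esub>}"
      using 7 finite_vimageI[OF component_props(2)[of "fst a"], of "\<lambda>n. n - k"]
      by (auto simp: simps vimage_def inj_on_def)
    then have "finite ({n. component M (n - k) (fst a) \<noteq> \<zero>\<^bsub>M\<^esub>} \<union> {n. component M n (snd a) \<noteq> \<zero>\<^bsub>M\<^esub>})"
      using 7 component_props(2)[of "snd a"] by (auto simp: simps)
    then show ?case by (rule finite_subset[rotated]) (auto simp: simps)
  next
    case (8 a)
    have "component M n (fst a) = \<zero>\<^bsub>M\<^esub>" for n using 8(2)[of "n + k"] by (simp add: simps)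
    moreover have "component M n (snd a) = \<zero>\<^bsub>M\<^esub>" for n using 8(2)[of n] by (simp add: simps)
    ultimately show ?case
      using component_inject_zero[of "fst a"] component_inject_zero[of "snd a"] 8(1) by (auto simp: simps)
  qed (auto simp: simps component_props component_add component_homogeneous)
qed

text \<open>
  Covariant differentiation along the single vector field \<open>\<delta>\<close>, homogeneous of the same degree as \<open>\<delta>\<close>.
\<close>

definition connection ::
    "(('v::finite, 'a::comm_ring_1) mpolynomial \<Rightarrow> ('v, 'a) mpolynomial) \<Rightarrow> int \<Rightarrow>
     (('v, 'a) mpolynomial, 'b) graded_module \<Rightarrow> ('b \<Rightarrow> 'b) \<Rightarrow> bool"
  where "connection \<delta> k M \<theta> \<longleftrightarrow> \<theta> \<in> carrier M \<rightarrow> carrier M \<and>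
    (\<forall>x\<in>carrier M. \<forall>y\<in>carrier M. \<theta> (x \<oplus>\<^bsub>M\<^esub> y) = \<theta> x \<oplus>\<^bsub>M\<^esub> \<theta> y) \<and>
    (\<forall>p. \<forall>x\<in>carrier M. \<theta> (p \<odot>\<^bsub>M\<^esub> x) = p \<odot>\<^bsub>M\<^esub> \<theta> x \<oplus>\<^bsub>M\<^esub> \<delta> p \<odot>\<^bsub>M\<^esub> x) \<and>
    (\<forall>n. \<theta> ` grade M n \<subseteq> grade M (n + k))"

lemma connectionD:
  assumes "connection \<delta> k M \<theta>"
  shows "x \<in> carrier M \<Longrightarrow> \<theta> x \<in> carrier M"
    "x \<in> carrier M \<Longrightarrow> y \<in> carrier M \<Longrightarrow> \<theta> (x \<oplus>\<^bsub>M\<^esub> y) = \<theta> x \<oplus>\<^bsub>M\<^esub> \<theta> y"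
    "x \<in> carrier M \<Longrightarrow> \<theta> (p \<odot>\<^bsub>M\<^esub> x) = p \<odot>\<^bsub>M\<^esub> \<theta> x \<oplus>\<^bsub>M\<^esub> \<delta> p \<odot>\<^bsub>M\<^esub> x"
    "x \<in> grade M n \<Longrightarrow> \<theta> x \<in> grade M (n + k)"
  using assms unfolding connection_def by blast+

text \<open>
  The additive map \<open>s\<close> is constant on the fibres of \<open>g\<close>, because it kills the kernel of \<open>g\<close>.
\<close>

lemma factor_through_image:
  assumes "abelian_group P" "abelian_group M" "abelian_group Q"
    and g: "\<And>x. x \<in> carrier P \<Longrightarrow> g x \<in> carrier M"
      "\<And>x y. x \<in> carrier P \<Longrightarrow> y \<in> carrier P \<Longrightarrow> g (x \<oplus>\<^bsub>P\<^esub> y) = g x \<oplus>\<^bsub>M\<^esub> g y"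
    and s: "\<And>x. x \<in> carrier P \<Longrightarrow> s x \<in> carrier Q"
      "\<And>x y. x \<in> carrier P \<Longrightarrow> y \<in> carrier P \<Longrightarrow> s (x \<oplus>\<^bsub>P\<^esub> y) = s x \<oplus>\<^bsub>Q\<^esub> s y"
    and ker: "\<And>x. x \<in> carrier P \<Longrightarrow> g x = \<zero>\<^bsub>M\<^esub> \<Longrightarrow> s x = \<zero>\<^bsub>Q\<^esub>"
  shows "\<exists>f. \<forall>x\<in>carrier P. f (g x) = s x"
proof -
  interpret P: abelian_group P by fact
  interpret M: abelian_group M by fact
  interpret Q: abelian_group Q by fact
  have eq: "s x = s y" if "x \<in> carrier P" "y \<in> carrier P" "g x = g y" for x y
  proof -
    let ?z = "x \<ominus>\<^bsub>P\<^esub> y"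
    have z: "?z \<in> carrier P" "x = ?z \<oplus>\<^bsub>P\<^esub> y"
      using that by (simp_all add: P.minus_eq P.a_assoc P.l_neg)
    then have "g x = g ?z \<oplus>\<^bsub>M\<^esub> g x" using g(2)[OF z(1) that(2)] that(3) by simp
    then have "g ?z = \<zero>\<^bsub>M\<^esub>" using g(1) z(1) that(1) by (metis M.add.r_cancel_one')
    then have "s ?z = \<zero>\<^bsub>Q\<^esub>" using ker z(1) by blast
    then show ?thesis using s(2)[OF z(1) that(2)] z(2) s(1)[OF that(2)] by simp
  qed
  have "s (SOME z. z \<in> carrier P \<and> g z = g x) = s x" if "x \<in> carrier P" for x
    using someI[of "\<lambda>z. z \<in> carrier P \<and> g z = g x" x] that eq by blast
  then show ?thesis by (intro exI[of _ "\<lambda>y. s (SOME z. z \<in> carrier P \<and> g z = y)"]) blast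
qed

text \<open>
  A homogeneous element in the image of a graded homomorphism has a homogeneous preimage of the same
  degree, namely the component of any preimage. It makes the maps induced on images homogeneous.
\<close>

lemma graded_preimage:
  assumes "graded_module P" "graded_module M" "g \<in> graded_hom P M" "x \<in> carrier P" "g x \<in> grade M n"
  shows "g x = g (component P n x)" "component P n x \<in> grade P n" "component P n x \<in> carrier P"
proof -
  interpret P: graded_module P by fact
  interpret M: graded_module M by fact
  show "g x = g (component P n x)"
    using M.component_homogeneous[OF assms(5), of n] graded_hom_component[OF assms(1-4), of n] by simp
  show "component P n x \<in> grade P n" "component P n x \<in> carrier P"
    using assms(4) P.component_props(1) by auto
qed

text \<open>
  The map \<open>f\<close> induces a homomorphism on the image of \<open>g\<close>, which extends to \<open>M\<close> as \<open>F\<close> is injective.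
\<close>

lemma hom_factor_extend:
  fixes P :: "(('v::finite, 'a::comm_ring_1) mpolynomial, 'b) graded_module"
    and M F :: "(('v, 'a) mpolynomial, 'e) graded_module"
  assumes "graded_module P" "graded_module M" "graded_injective F"
    and g: "g \<in> graded_hom P M" and f: "f \<in> graded_hom P F"
    and ker: "\<And>x. x \<in> carrier P \<Longrightarrow> g x = \<zero>\<^bsub>M\<^esub> \<Longrightarrow> f x = \<zero>\<^bsub>F\<^esub>"
  shows "\<exists>h\<in>graded_hom M F. \<forall>x\<in>carrier P. h (g x) = f x"
proof -
  have "graded_module F" using assms(3) by (simp add: graded_injective_def)
  interpret P: graded_module P by fact
  interpret M: graded_module M by fact
  interpret F: graded_module F by fact
  note gD = graded_homD[OF g] and fD = graded_homD[OF f]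
  have "\<exists>f'. \<forall>x\<in>carrier P. f' (g x) = f x"
    by (rule factor_through_image[OF P.M.abelian_group_axioms M.M.abelian_group_axioms F.M.abelian_group_axioms])
      (simp_all add: gD fD ker)
  then obtain f' where f': "\<And>x. x \<in> carrier P \<Longrightarrow> f' (g x) = f x" by blast
  let ?L = "submodule_of (g ` carrier P) M"
  have L: "graded_module ?L"
    by (intro graded_module_submodule_of graded_submodule_image assms g)
  have "f' y \<in> grade F n" if y: "y \<in> grade M n \<inter> g ` carrier P" for y n
  proof -
    obtain x where x: "x \<in> carrier P" "y = g x" using y by blast
    with y have "g x \<in> grade M n" by simp
    from graded_preimage[OF assms(1,2) g x(1) this] show ?thesis
      using f' fD(4) x(2) by metis
  qed
  moreover have "f' (y \<oplus>\<^bsub>M\<^esub> z) = f' y \<oplus>\<^bsub>F\<^esub> f' z" if yz: "y \<in> g ` carrier P" "z \<in> g ` carrier P" for y z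
  proof -
    from yz obtain x x' where "x \<in> carrier P" "y = g x" "x' \<in> carrier P" "z = g x'" by blast
    then show ?thesis using gD(2)[of x x', symmetric] by (simp add: f' fD)
  qed
  moreover have "f' (p \<odot>\<^bsub>M\<^esub> y) = p \<odot>\<^bsub>F\<^esub> f' y" if y: "y \<in> g ` carrier P" for p y
  proof -
    from y obtain x where "x \<in> carrier P" "y = g x" by blast
    then show ?thesis using gD(3)[of x p, symmetric] by (simp add: f' fD)
  qed
  moreover have "f' y \<in> carrier F" if "y \<in> g ` carrier P" for y using that f' fD(1) by auto
  ultimately have f'_hom: "f' \<in> graded_hom ?L F"
    unfolding graded_hom_def by (auto simp: submodule_of_def)
  have "(\<lambda>x. x) \<in> graded_hom ?L M"
    using gD(1) by (auto simp: graded_hom_def submodule_of_def)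
  from graded_injective_extend[OF assms(3) inj_on_id2 L assms(2) this inj_on_id2 f'_hom]
  have "\<exists>h\<in>graded_hom M F. \<forall>x\<in>carrier ?L. h x = f' x" .
  then show ?thesis using f' by (auto simp: submodule_of_def)
qed

text \<open>
  The connection \<open>\<sigma>\<close> induces a map \<open>f'\<close> on the image \<open>N\<close> of \<open>g\<close>. Then \<open>(y, e) \<mapsto> e - f' y\<close> is \<open>R\<close>-linear
  on the extension of \<open>N\<close> by \<open>M\<close>, and injectivity of \<open>M\<close> extends it to a retraction \<open>\<rho>\<close> of the extension of
  \<open>M\<close> by \<open>M\<close>. The connection that belongs to this splitting is \<open>\<theta> x = - \<rho> (x, 0)\<close>. The extension lives
  on pairs; an infinite type contains a copy of its own square, so \<open>M\<close> may be tested against it.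
\<close>

lemma connection_extend:
  fixes P :: "(('v::finite, 'a::comm_ring_1) mpolynomial, 'b) graded_module"
    and M :: "(('v, 'a) mpolynomial, 'e) graded_module"
  assumes "graded_module P" "graded_injective M" "infinite (UNIV :: 'e set)" "derivation \<delta> k"
    and \<sigma>: "connection \<delta> k P \<sigma>" and g: "g \<in> graded_hom P M"
    and ker: "\<And>x. x \<in> carrier P \<Longrightarrow> g x = \<zero>\<^bsub>M\<^esub> \<Longrightarrow> g (\<sigma> x) = \<zero>\<^bsub>M\<^esub>"
  shows "\<exists>\<theta>. connection \<delta> k M \<theta> \<and> (\<forall>x\<in>carrier P. \<theta> (g x) = g (\<sigma> x))"
proof -
  have M_graded: "graded_module M" using assms(2) by (simp add: graded_injective_def)
  interpret P: graded_module P by fact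
  interpret M: graded_module M by fact
  note gD = graded_homD[OF g] and \<sigma>D = connectionD[OF \<sigma>] and \<delta>D = derivationD[OF assms(4)]
  obtain \<pi> :: "'e \<times> 'e \<Rightarrow> 'e" where \<pi>: "inj \<pi>"
    using card_of_Times_same_infinite[OF assms(3)] 
    unfolding card_of_ordIso[symmetric] bij_betw_def by auto
  have "\<exists>f'. \<forall>x\<in>carrier P. f' (g x) = g (\<sigma> x)"
    by (rule factor_through_image[OF P.M.abelian_group_axioms M.M.abelian_group_axioms M.M.abelian_group_axioms])
      (simp_all add: gD \<sigma>D ker)
  then obtain f' where f': "\<And>x. x \<in> carrier P \<Longrightarrow> f' (g x) = g (\<sigma> x)" by blast
  let ?N = "g ` carrier P"
  have N: "graded_submodule ?N M" by (rule graded_submodule_image[OF assms(1) M_graded g])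
  have f'_closed: "f' y \<in> carrier M" if "y \<in> ?N" for y
    using that f' gD(1) \<sigma>D(1) by auto
  have f'_add: "f' (y \<oplus>\<^bsub>M\<^esub> z) = f' y \<oplus>\<^bsub>M\<^esub> f' z" if yz: "y \<in> ?N" "z \<in> ?N" for y z
  proof -
    from yz obtain x x' where "x \<in> carrier P" "y = g x" "x' \<in> carrier P" "z = g x'" by blast
    moreover from this have "f' (y \<oplus>\<^bsub>M\<^esub> z) = g (\<sigma> (x \<oplus>\<^bsub>P\<^esub> x'))" using gD(2)[of x x', symmetric] by (simp add: f')
    ultimately show ?thesis by (simp add: f' \<sigma>D(1,2) gD(2))
  qed
  have f'_smult: "f' (p \<odot>\<^bsub>M\<^esub> y) = p \<odot>\<^bsub>M\<^esub> f' y \<oplus>\<^bsub>M\<^esub> \<delta> p \<odot>\<^bsub>M\<^esub> y" if y: "y \<in> ?N" for p y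
  proof -
    from y obtain x where x: "x \<in> carrier P" "y = g x" by blast
    then have "f' (p \<odot>\<^bsub>M\<^esub> y) = g (\<sigma> (p \<odot>\<^bsub>P\<^esub> x))" using gD(3)[of x p, symmetric] by (simp add: f')
    then show ?thesis using x by (simp add: \<sigma>D(1,3) gD(2,3) f')
  qed
  have f'_grade: "f' y \<in> grade M n" if y: "y \<in> grade M (n - k) \<inter> ?N" for y n
  proof -
    obtain x where x: "x \<in> carrier P" "y = g x" using y by blast
    with y have "g x \<in> grade M (n - k)" by simp
    from graded_preimage[OF assms(1) M_graded g x(1) this] show ?thesis
      using f' gD(4) \<sigma>D(4)[of _ "n - k"] x(2) by (metis diff_add_cancel)
  qed
  let ?L = "derivation_extension \<delta> k ?N M" and ?X = "derivation_extension \<delta> k (carrier M) M"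
  have L: "graded_module ?L" and X: "graded_module ?X"
    using graded_module_derivation_extension[OF M_graded _ assms(4)] N graded_submodule_carrier[OF M_graded] by auto
  note simps = derivation_extension_def
  have "(\<lambda>a. snd a \<ominus>\<^bsub>M\<^esub> f' (fst a)) \<in> graded_hom ?L M"
    unfolding graded_hom_def
  proof (intro CollectI conjI ballI allI Pi_I subsetI, goal_cases)
    case (1 a)
    then show ?case by (auto simp: simps f'_closed)
  next
    case (2 a b)
    then obtain y e z e' where [simp]: "a = (y, e)" "b = (z, e')"
      and *: "y \<in> ?N" "e \<in> carrier M" "z \<in> ?N" "e' \<in> carrier M" by (auto simp: simps)
    show ?case using f'_closed[OF *(1)] f'_closed[OF *(3)] *(2,4)
      by (simp add: simps f'_add[OF *(1,3)] M.minus_eq M.minus_add M.a_ac)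
  next
    case (3 p a)
    then obtain y e where [simp]: "a = (y, e)" and *: "y \<in> ?N" "e \<in> carrier M" by (auto simp: simps)
    have y: "y \<in> carrier M" using * gD(1) by auto
    have "p \<odot>\<^bsub>M\<^esub> e \<oplus>\<^bsub>M\<^esub> w \<ominus>\<^bsub>M\<^esub> (p \<odot>\<^bsub>M\<^esub> f' y \<oplus>\<^bsub>M\<^esub> w) = p \<odot>\<^bsub>M\<^esub> (e \<ominus>\<^bsub>M\<^esub> f' y)"
      if "w \<in> carrier M" for w
    proof -
      have "p \<odot>\<^bsub>M\<^esub> (e \<ominus>\<^bsub>M\<^esub> f' y) = p \<odot>\<^bsub>M\<^esub> e \<ominus>\<^bsub>M\<^esub> p \<odot>\<^bsub>M\<^esub> f' y"
        using * f'_closed[OF *(1)] by (simp add: M.minus_eq M.scalar_distribs M.smult_r_minus)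
      then show ?thesis using * f'_closed[OF *(1)] \<open>w \<in> carrier M\<close> by (simp add: M.M.minus_add_cancel_right)
    qed
    then show ?case using y by (simp add: simps f'_smult[OF *(1)])
  next
    case (4 n b)
    then obtain y e where b: "b = e \<ominus>\<^bsub>M\<^esub> f' y" and *: "y \<in> grade M (n - k) \<inter> ?N" "e \<in> grade M n"
      by (auto simp: simps)
    show ?case unfolding b M.minus_eq using f'_grade[OF *(1)] *(2)
      by (intro M.grade.a_closed M.grade.a_inv_closed)
  qed
  moreover have "(\<lambda>a. a) \<in> graded_hom ?L ?X"
    using gD(1) M.grade_carrier by (auto simp: graded_hom_def simps)
  ultimately obtain \<rho> where \<rho>: "\<rho> \<in> graded_hom ?X M"
    "\<And>a. a \<in> carrier ?L \<Longrightarrow> \<rho> a = snd a \<ominus>\<^bsub>M\<^esub> f' (fst a)"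
    using graded_injective_extend[OF assms(2) \<pi> L X _ inj_on_id2] by blast
  note \<rho>D = graded_homD[OF \<rho>(1)]
  define \<theta> where "\<theta> x = \<ominus>\<^bsub>M\<^esub> \<rho> (x, \<zero>\<^bsub>M\<^esub>)" for x
  have \<rho>_closed: "\<rho> (x, \<zero>\<^bsub>M\<^esub>) \<in> carrier M" if "x \<in> carrier M" for x
    using \<rho>D(1)[of "(x, \<zero>\<^bsub>M\<^esub>)"] that by (simp add: simps)
  have zero_N: "\<zero>\<^bsub>M\<^esub> \<in> ?N" using N by (simp add: graded_submodule_def)
  have "f' \<zero>\<^bsub>M\<^esub> = \<zero>\<^bsub>M\<^esub>" using f'_smult[OF zero_N, of 0] f'_closed[OF zero_N] by simp
  then have \<rho>_snd: "\<rho> (\<zero>\<^bsub>M\<^esub>, e) = e" if "e \<in> carrier M" for e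
    using \<rho>(2)[of "(\<zero>\<^bsub>M\<^esub>, e)"] that zero_N by (simp add: simps M.minus_eq)
  have "connection \<delta> k M \<theta>"
    unfolding connection_def
  proof (intro conjI ballI allI Pi_I subsetI, goal_cases)
    case (1 x)
    then show ?case by (simp add: \<theta>_def \<rho>_closed)
  next
    case (2 x y)
    have "\<rho> (x \<oplus>\<^bsub>M\<^esub> y, \<zero>\<^bsub>M\<^esub>) = \<rho> (x, \<zero>\<^bsub>M\<^esub>) \<oplus>\<^bsub>M\<^esub> \<rho> (y, \<zero>\<^bsub>M\<^esub>)"
      using \<rho>D(2)[of "(x, \<zero>\<^bsub>M\<^esub>)" "(y, \<zero>\<^bsub>M\<^esub>)"] 2 by (simp add: simps)
    then show ?case using 2 by (simp add: \<theta>_def \<rho>_closed M.minus_add)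
  next
    case (3 p x)
    have "\<rho> (p \<odot>\<^bsub>M\<^esub> x, \<delta> p \<odot>\<^bsub>M\<^esub> x) = p \<odot>\<^bsub>M\<^esub> \<rho> (x, \<zero>\<^bsub>M\<^esub>)"
      using \<rho>D(3)[of "(x, \<zero>\<^bsub>M\<^esub>)" p] 3 by (simp add: simps)
    moreover have "\<rho> (p \<odot>\<^bsub>M\<^esub> x, \<delta> p \<odot>\<^bsub>M\<^esub> x) = \<rho> (p \<odot>\<^bsub>M\<^esub> x, \<zero>\<^bsub>M\<^esub>) \<oplus>\<^bsub>M\<^esub> \<delta> p \<odot>\<^bsub>M\<^esub> x"
      using \<rho>D(2)[of "(p \<odot>\<^bsub>M\<^esub> x, \<zero>\<^bsub>M\<^esub>)" "(\<zero>\<^bsub>M\<^esub>, \<delta> p \<odot>\<^bsub>M\<^esub> x)"] 3 by (simp add: simps \<rho>_snd)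
    ultimately have "p \<odot>\<^bsub>M\<^esub> \<rho> (x, \<zero>\<^bsub>M\<^esub>) = \<rho> (p \<odot>\<^bsub>M\<^esub> x, \<zero>\<^bsub>M\<^esub>) \<oplus>\<^bsub>M\<^esub> \<delta> p \<odot>\<^bsub>M\<^esub> x" by simp
    then have "p \<odot>\<^bsub>M\<^esub> \<theta> x = \<ominus>\<^bsub>M\<^esub> (\<rho> (p \<odot>\<^bsub>M\<^esub> x, \<zero>\<^bsub>M\<^esub>) \<oplus>\<^bsub>M\<^esub> \<delta> p \<odot>\<^bsub>M\<^esub> x)"
      using 3 by (simp add: \<theta>_def \<rho>_closed M.smult_r_minus)
    then show ?case using 3 by (simp add: \<theta>_def \<rho>_closed M.minus_add M.a_assoc M.l_neg)
  next
    case (4 n y)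
    then obtain x where x: "x \<in> grade M n" "y = \<theta> x" by blast
    then have "\<rho> (x, \<zero>\<^bsub>M\<^esub>) \<in> grade M (n + k)"
      by (intro \<rho>D(4)) (auto simp: simps M.grade_carrier M.grade.zero_closed)
    then show ?case by (simp add: \<theta>_def x(2) M.grade.a_inv_closed)
  qed
  moreover have "\<theta> (g x) = g (\<sigma> x)" if x: "x \<in> carrier P" for x
    using \<rho>(2)[of "(g x, \<zero>\<^bsub>M\<^esub>)"] x f'[OF x] gD(1) \<sigma>D(1)
    by (simp add: \<theta>_def simps M.minus_eq)
  ultimately show ?thesis by blast
qed

text \<open>
  The operator that multiplies each homogeneous element by its degree.
\<close>

definition degree_operator ::
    "(('v::finite, 'a::comm_ring_1) mpolynomial, 'b, 'c) graded_module_scheme \<Rightarrow> 'b \<Rightarrow> 'b"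
  where "degree_operator M x = finsum M (\<lambda>n. of_int n \<odot>\<^bsub>M\<^esub> component M n x) {n. component M n x \<noteq> \<zero>\<^bsub>M\<^esub>}"

context graded_module
begin

lemma degree_operator_eq:
  assumes "x \<in> carrier M" "finite S" "{n. component M n x \<noteq> \<zero>} \<subseteq> S"
  shows "degree_operator M x = finsum M (\<lambda>n. of_int n \<odot> component M n x) S"
  unfolding degree_operator_def
  using assms by (intro M.add.finprod_mono_neutral_cong_left) auto

lemma degree_operator_closed [simp]: "x \<in> carrier M \<Longrightarrow> degree_operator M x \<in> carrier M"
  by (auto simp: degree_operator_def intro!: M.finsum_closed)

lemma degree_operator_homogeneous:
  assumes "x \<in> grade M n"
  shows "degree_operator M x = of_int n \<odot> x"
proof -
  have "degree_operator M x = finsum M (\<lambda>k. of_int k \<odot> component M k x) {n}"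
    using grade_carrier[OF assms] by (intro degree_operator_eq) (auto simp: component_homogeneous[OF assms])
  then show ?thesis using grade_carrier[OF assms] by (simp add: component_homogeneous[OF assms])
qed

lemma degree_operator_add:
  assumes "x \<in> carrier M" "y \<in> carrier M"
  shows "degree_operator M (x \<oplus> y) = degree_operator M x \<oplus> degree_operator M y"
proof -
  let ?S = "{n. component M n x \<noteq> \<zero>} \<union> {n. component M n y \<noteq> \<zero>}"
  have fin: "finite ?S" using component_props(2) assms by blast
  have "{n. component M n (x \<oplus> y) \<noteq> \<zero>} \<subseteq> ?S" using assms by (auto simp: component_add)
  then have "degree_operator M (x \<oplus> y) = finsum M (\<lambda>n. of_int n \<odot> component M n (x \<oplus> y)) ?S"
    using assms fin by (intro degree_operator_eq) auto
  also have "\<dots> = finsum M (\<lambda>n. of_int n \<odot> component M n x \<oplus> of_int n \<odot> component M n y) ?S"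
    using assms by (intro M.finsum_cong') (auto simp: component_add scalar_distribs)
  also have "\<dots> = finsum M (\<lambda>n. of_int n \<odot> component M n x) ?S \<oplus> finsum M (\<lambda>n. of_int n \<odot> component M n y) ?S"
    using assms by (intro M.finsum_addf) auto
  also have "\<dots> = degree_operator M x \<oplus> degree_operator M y"
    using assms fin by (simp add: degree_operator_eq[of x ?S] degree_operator_eq[of y ?S])
  finally show ?thesis .
qed

lemma degree_operator_grade: "x \<in> grade M n \<Longrightarrow> degree_operator M x \<in> grade M n"
  using grade_smult[OF of_int_homogeneous, of x n] by (simp add: degree_operator_homogeneous)

text \<open>
  By Euler's formula, \<open>deg (p x) = deg p + deg x\<close> says that the degree operator satisfies the Leibniz rule
  for the Euler derivation \<open>\<Sum> X\<^sub>v \<partial>\<^sub>v\<close>.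
\<close>

lemma degree_operator_smult:
  assumes "x \<in> carrier M"
  shows "degree_operator M (p \<odot> x) = p \<odot> degree_operator M x \<oplus> (\<Sum>v\<in>UNIV. var v * partial v p) \<odot> x"
proof (induction p rule: mpolynomial_induct)
  case (monomial t a)
  define p where "p = Poly_Mapping.single t a"
  define k where "k = int (monomial_degree t)"
  have p: "p \<in> grade poly_graded k" unfolding p_def k_def by (rule monomial_homogeneous)
  from assms have "degree_operator M (p \<odot> x) = p \<odot> degree_operator M x \<oplus> (of_int k * p) \<odot> x"
  proof (induction x rule: homogeneous_induct)
    case (homogeneous n x)
    have x: "x \<in> carrier M" using homogeneous grade_carrier by blast
    have "degree_operator M (p \<odot> x) = (of_int (k + n) * p) \<odot> x"
      using degree_operator_homogeneous[OF grade_smult[OF p homogeneous]] x by (simp add: scalar_distribs)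
    also have "\<dots> = (p * of_int n + of_int k * p) \<odot> x" by (simp add: algebra_simps)
    finally show ?case using x by (simp add: degree_operator_homogeneous[OF homogeneous] scalar_distribs)
  next
    case (add x y)
    then show ?case by (simp add: scalar_distribs degree_operator_add M.a_ac)
  qed
  then show ?case using euler_formula[OF p] by (simp add: p_def)
next
  case (add p q)
  have "(\<Sum>v\<in>UNIV. var v * partial v (p + q)) = (\<Sum>v\<in>UNIV. var v * partial v p) + (\<Sum>v\<in>UNIV. var v * partial v q)"
    by (simp add: partial_add algebra_simps sum.distrib)
  then show ?case using assms add by (simp add: scalar_distribs degree_operator_add M.a_ac)
qed

end

lemma graded_hom_degree_operator:
  assumes "graded_module M" "graded_module N" "h \<in> graded_hom M N" "x \<in> carrier M"
  shows "h (degree_operator M x) = degree_operator N (h x)"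
proof -
  interpret M: graded_module M by fact
  interpret N: graded_module N by fact
  note h = graded_homD[OF assms(3)]
  from assms(4) show ?thesis
  proof (induction x rule: M.homogeneous_induct)
    case (homogeneous n x)
    then show ?case
      using M.degree_operator_homogeneous[OF homogeneous] N.degree_operator_homogeneous[OF h(4)[OF homogeneous]]
        h(3) M.grade_carrier by simp
  next
    case (add x y)
    then show ?case by (simp add: h(1,2) M.degree_operator_add N.degree_operator_add)
  qed
qed

lemma derivation_connection: "derivation \<delta> k \<Longrightarrow> connection \<delta> k poly_graded \<delta>"
  by (auto simp: connection_def derivationD)

lemma graded_hom_minus:
  assumes "graded_module M" "graded_module N" "f \<in> graded_hom M N" "g \<in> graded_hom M N"
  shows "(\<lambda>x. f x \<ominus>\<^bsub>N\<^esub> g x) \<in> graded_hom M N"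
proof -
  interpret M: graded_module M by fact
  interpret N: graded_module N by fact
  note f = graded_homD[OF assms(3)] and g = graded_homD[OF assms(4)]
  show ?thesis
    unfolding graded_hom_def
  proof (intro CollectI conjI ballI allI Pi_I subsetI, goal_cases)
    case (1 x)
    then show ?case by (simp add: f g)
  next
    case (2 x y)
    then show ?case by (simp add: f g N.M.minus_eq N.M.minus_add N.M.a_ac)
  next
    case (3 p x)
    then show ?case by (simp add: f g N.M.minus_eq N.scalar_distribs N.smult_r_minus)
  next
    case (4 n y)
    then show ?case unfolding N.M.minus_eq by (auto intro!: N.grade.a_closed N.grade.a_inv_closed f g)
  qed
qed

section \<open>Lifting derivations and homotopies to a resolution\<close>

locale graded_resolution =
  fixes \<epsilon> :: "('v::finite, 'a::comm_ring_1) mpolynomial \<Rightarrow> 'e"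
    and E :: "nat \<Rightarrow> (('v, 'a) mpolynomial, 'e) graded_module"
    and d :: "nat \<Rightarrow> 'e \<Rightarrow> 'e"
  assumes resolution: "graded_injective_resolution \<epsilon> E d"
begin

lemma injective: "graded_injective (E i)"
  and augmentation: "\<epsilon> \<in> graded_hom poly_graded (E 0)"
  and differential: "d i \<in> graded_hom (E i) (E (Suc i))"
  and augmentation_inj: "inj \<epsilon>"
  and exact_zero: "range \<epsilon> = {x \<in> carrier (E 0). d 0 x = \<zero>\<^bsub>E (Suc 0)\<^esub>}"
  and exact_Suc: "d i ` carrier (E i) = {x \<in> carrier (E (Suc i)). d (Suc i) x = \<zero>\<^bsub>E (Suc (Suc i))\<^esub>}"
  using resolution by (auto simp: graded_injective_resolution_def)

lemma graded: "graded_module (E i)"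
  using injective by (simp add: graded_injective_def)

sublocale E: graded_module "E i" for i
  by (rule graded)

lemmas d = graded_homD[OF differential]
lemmas eps = graded_homD[OF augmentation, simplified]
lemma d_zero: "d i \<zero>\<^bsub>E i\<^esub> = \<zero>\<^bsub>E (Suc i)\<^esub>"
  by (rule graded_hom_zero[OF graded graded differential])

lemma d_d: "x \<in> carrier (E i) \<Longrightarrow> d (Suc i) (d i x) = \<zero>\<^bsub>E (Suc (Suc i))\<^esub>"
  using exact_Suc[of i] by blast

lemma d_eps: "d 0 (\<epsilon> p) = \<zero>\<^bsub>E (Suc 0)\<^esub>"
  using exact_zero by blast

text \<open>
  The lifts are constructed one term at a time. For the next step \<open>\<theta>\<close> must preserve the kernel of the
  differential, which is part of the induction hypothesis; it follows from exactness, since \<open>\<theta>\<close> commutes with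
  the preceding differential.
\<close>

lemma lift_derivation:
  assumes "infinite (UNIV :: 'e set)" "derivation \<delta> k"
  obtains \<theta> where "\<And>i. connection \<delta> k (E i) (\<theta> i)"
    and "\<And>i x. x \<in> carrier (E i) \<Longrightarrow> \<theta> (Suc i) (d i x) = d i (\<theta> i x)"
    and "\<And>p. \<theta> 0 (\<epsilon> p) = \<epsilon> (\<delta> p)"
proof -
  let ?P = "\<lambda>i \<theta>. connection \<delta> k (E i) \<theta> \<and>
    (\<forall>x\<in>carrier (E i). d i x = \<zero>\<^bsub>E (Suc i)\<^esub> \<longrightarrow> d i (\<theta> x) = \<zero>\<^bsub>E (Suc i)\<^esub>) \<and>
    (i = 0 \<longrightarrow> (\<forall>p. \<theta> (\<epsilon> p) = \<epsilon> (\<delta> p)))"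
  let ?Q = "\<lambda>i \<theta> \<theta>'. \<forall>x\<in>carrier (E i). \<theta>' (d i x) = d i (\<theta> x)"
  have zero: "\<exists>\<theta>. ?P 0 \<theta>"
  proof -
    have "\<epsilon> (\<delta> p) = \<zero>\<^bsub>E 0\<^esub>" if "\<epsilon> p = \<zero>\<^bsub>E 0\<^esub>" for p
    proof -
      have "\<epsilon> 0 = \<zero>\<^bsub>E 0\<^esub>" using graded_hom_zero[OF poly_graded_module graded augmentation] by simp
      with that have "p = 0" using augmentation_inj by (metis injD)
      then show ?thesis using that by (simp add: derivationD[OF assms(2)])
    qed
    then obtain \<theta> where \<theta>: "connection \<delta> k (E 0) \<theta>" "\<And>p. \<theta> (\<epsilon> p) = \<epsilon> (\<delta> p)"
      using connection_extend[OF poly_graded_module injective assms derivation_connection[OF assms(2)] augmentation]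
      by auto
    moreover have "d 0 (\<theta> x) = \<zero>\<^bsub>E (Suc 0)\<^esub>" if "x \<in> carrier (E 0)" "d 0 x = \<zero>\<^bsub>E (Suc 0)\<^esub>" for x
    proof -
      from that exact_zero have "x \<in> range \<epsilon>" by blast
      then obtain p where "x = \<epsilon> p" by blast
      then show ?thesis by (simp add: \<theta>(2) d_eps)
    qed
    ultimately show ?thesis by blast
  qed
  have step: "\<exists>\<theta>'. ?P (Suc i) \<theta>' \<and> ?Q i \<theta> \<theta>'" if P: "?P i \<theta>" for i \<theta>
  proof -
    obtain \<theta>' where \<theta>': "connection \<delta> k (E (Suc i)) \<theta>'" "\<And>x. x \<in> carrier (E i) \<Longrightarrow> \<theta>' (d i x) = d i (\<theta> x)"
      using connection_extend[OF graded injective assms _ differential] P by blast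
    moreover have "d (Suc i) (\<theta>' x) = \<zero>\<^bsub>E (Suc (Suc i))\<^esub>"
      if "x \<in> carrier (E (Suc i))" "d (Suc i) x = \<zero>\<^bsub>E (Suc (Suc i))\<^esub>" for x
    proof -
      from that exact_Suc[of i] have "x \<in> d i ` carrier (E i)" by blast
      then obtain y where y: "y \<in> carrier (E i)" "x = d i y" by blast
      moreover have "\<theta> y \<in> carrier (E i)" using y(1) conjunct1[OF P] by (rule connectionD(1)[rotated])
      ultimately show ?thesis by (simp add: \<theta>'(2) d_d)
    qed
    ultimately show ?thesis by blast
  qed
  have "\<exists>\<theta>. \<forall>i. ?P i (\<theta> i) \<and> ?Q i (\<theta> i) (\<theta> (Suc i))"
    by (rule dependent_nat_choice[of ?P ?Q, OF zero step])
  then obtain \<theta> where \<theta>: "\<forall>i. ?P i (\<theta> i) \<and> ?Q i (\<theta> i) (\<theta> (Suc i))" ..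
  show thesis by (rule that[of \<theta>]) (use \<theta> in simp_all)
qed

text \<open>
  The usual comparison argument: with \<open>h\<^sub>i\<close> already constructed, \<open>\<phi> - d h\<^sub>i\<close> kills the cycles and thus factors
  through \<open>d\<close>; extending the factor to the next term gives \<open>h\<^bsub>i+1\<^esub>\<close>. On cycles the homotopy
  formula \<open>\<phi> = d h + h d\<close> reduces to \<open>\<phi> = d h\<close>, and only this is recorded.
\<close>

lemma null_homotopy:
  assumes \<phi>: "\<And>i. \<phi> i \<in> graded_hom (E i) (E i)"
    and comm: "\<And>i x. x \<in> carrier (E i) \<Longrightarrow> \<phi> (Suc i) (d i x) = d i (\<phi> i x)"
    and zero: "\<And>p. \<phi> 0 (\<epsilon> p) = \<zero>\<^bsub>E 0\<^esub>"
  shows "\<And>x. x \<in> carrier (E 0) \<Longrightarrow> d 0 x = \<zero>\<^bsub>E (Suc 0)\<^esub> \<Longrightarrow> \<phi> 0 x = \<zero>\<^bsub>E 0\<^esub>"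
    and "\<exists>h\<in>graded_hom (E (Suc i)) (E i). \<forall>x\<in>carrier (E (Suc i)).
      d (Suc i) x = \<zero>\<^bsub>E (Suc (Suc i))\<^esub> \<longrightarrow> \<phi> (Suc i) x = d i (h x)"
proof -
  note \<phi>D = graded_homD[OF \<phi>]
  show ker: "\<phi> 0 x = \<zero>\<^bsub>E 0\<^esub>" if "x \<in> carrier (E 0)" "d 0 x = \<zero>\<^bsub>E (Suc 0)\<^esub>" for x
  proof -
    from that exact_zero have "x \<in> range \<epsilon>" by blast
    then show ?thesis using zero by auto
  qed
  show "\<exists>h\<in>graded_hom (E (Suc i)) (E i). \<forall>x\<in>carrier (E (Suc i)).
      d (Suc i) x = \<zero>\<^bsub>E (Suc (Suc i))\<^esub> \<longrightarrow> \<phi> (Suc i) x = d i (h x)"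
  proof (induction i)
    case 0
    obtain h where h: "h \<in> graded_hom (E (Suc 0)) (E 0)" "\<And>x. x \<in> carrier (E 0) \<Longrightarrow> h (d 0 x) = \<phi> 0 x"
      using hom_factor_extend[OF graded graded injective differential[of 0] \<phi>[of 0] ker] by blast
    have "\<phi> (Suc 0) x = d 0 (h x)" if "x \<in> carrier (E (Suc 0))" "d (Suc 0) x = \<zero>\<^bsub>E (Suc (Suc 0))\<^esub>" for x
    proof -
      from that exact_Suc[of 0] have "x \<in> d 0 ` carrier (E 0)" by blast
      then show ?thesis using comm h(2) by auto
    qed
    with h(1) show ?case by blast
  next
    case (Suc i)
    then obtain h where h: "h \<in> graded_hom (E (Suc i)) (E i)"
      "\<And>x. x \<in> carrier (E (Suc i)) \<Longrightarrow> d (Suc i) x = \<zero>\<^bsub>E (Suc (Suc i))\<^esub> \<Longrightarrow> \<phi> (Suc i) x = d i (h x)"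
      by blast
    note hD = graded_homD[OF h(1)]
    let ?f = "\<lambda>x. \<phi> (Suc i) x \<ominus>\<^bsub>E (Suc i)\<^esub> d i (h x)"
    have f: "?f \<in> graded_hom (E (Suc i)) (E (Suc i))"
      by (rule graded_hom_minus[OF graded graded \<phi>]) (auto simp: graded_hom_def hD d)
    have "?f x = \<zero>\<^bsub>E (Suc i)\<^esub>" if "x \<in> carrier (E (Suc i))" "d (Suc i) x = \<zero>\<^bsub>E (Suc (Suc i))\<^esub>" for x
      using h(2)[OF that] that hD(1) d(1) by (simp add: E.M.minus_eq E.M.r_neg)
    then obtain h' where h': "h' \<in> graded_hom (E (Suc (Suc i))) (E (Suc i))"
      "\<And>x. x \<in> carrier (E (Suc i)) \<Longrightarrow> h' (d (Suc i) x) = ?f x"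
      using hom_factor_extend[OF graded graded injective differential[of "Suc i"] f] by blast
    have "\<phi> (Suc (Suc i)) x = d (Suc i) (h' x)"
      if x: "x \<in> carrier (E (Suc (Suc i)))" "d (Suc (Suc i)) x = \<zero>\<^bsub>E (Suc (Suc (Suc i)))\<^esub>" for x
    proof -
      from x exact_Suc[of "Suc i"] have "x \<in> d (Suc i) ` carrier (E (Suc i))" by blast
      then obtain y where y: "y \<in> carrier (E (Suc i))" "x = d (Suc i) y" by blast
      have c: "\<phi> (Suc i) y \<in> carrier (E (Suc i))" "d i (h y) \<in> carrier (E (Suc i))" "h y \<in> carrier (E i)"
        using y \<phi>D(1) d(1) hD(1) by auto
      have "\<phi> (Suc i) y = h' x \<oplus>\<^bsub>E (Suc i)\<^esub> d i (h y)"
        using c y by (simp add: h'(2) E.M.minus_eq E.M.a_assoc E.M.l_neg)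
      then have "d (Suc i) (\<phi> (Suc i) y) = d (Suc i) (h' x)"
        using c y x graded_homD(1)[OF h'(1)] by (simp add: d d_d)
      with y comm show ?thesis by simp
    qed
    with h'(1) show ?case by blast
  qed
qed

end

section \<open>Torsion and the Euler operator\<close>

lemma of_int_invertible:
  assumes "subfield K (ring_of_type_algebra :: 'a::comm_ring_1 ring)" "CHAR('a) = 0" "n \<noteq> 0"
  shows "\<exists>c::'a. c * of_int n = 1"
proof -
  interpret K: subfield K "ring_of_type_algebra :: 'a ring" by fact
  interpret R: cring "ring_of_type_algebra :: 'a ring" by (rule cring_from_type_algebra)
  note subring = subringE[OF K.subring_axioms]
  have nat_K: "(of_nat k :: 'a) \<in> K" for k
  proof (induction k)
    case 0
    show ?case using subring(2) by simp
  next
    case (Suc k)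
    then show ?case using subring(7)[of 1 "of_nat k"] subring(3) by simp
  qed
  define k where "k = nat \<bar>n\<bar>"
  have "k > 0" using assms(3) by (simp add: k_def)
  then have "(of_nat k :: 'a) \<noteq> 0" using assms(2) by (simp add: of_nat_eq_0_iff_char_dvd)
  then have "(of_nat k :: 'a) \<in> Units (ring_of_type_algebra \<lparr> carrier := K \<rparr>)"
    using K.subfield_Units nat_K[of k] by simp
  then obtain c :: 'a where "c * of_nat k = 1" by (auto simp: Units_def)
  moreover have "n = sgn n * int k" by (simp add: k_def mult_sgn_abs)
  then have "of_int n = of_int (sgn n) * (of_nat k :: 'a)" by (metis of_int_mult of_int_of_nat_eq)
  moreover have "of_int (sgn n) * of_int (sgn n) = (1 :: 'a)"
    using assms(3) by (simp add: sgn_if)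
  ultimately have "(c * of_int (sgn n)) * of_int n = (1::'a)" by (simp add: algebra_simps)
  then show ?thesis by blast
qed

lemma infinite_mpolynomial:
  assumes "CHAR('a::comm_ring_1) = 0"
  shows "infinite (UNIV :: ('v::finite, 'a) mpolynomial set)"
proof -
  have "(of_nat m :: 'a) \<noteq> of_nat n" if "m < n" for m n
    using of_nat_diff[of m n, where ?'a = 'a] of_nat_eq_0_iff_char_dvd[of "n - m", where ?'a = 'a] that assms by auto
  then have "inj (of_nat :: nat \<Rightarrow> 'a)" by (rule linorder_injI)
  then have "inj ((Poly_Mapping.single 0 :: 'a \<Rightarrow> ('v, 'a) mpolynomial) \<circ> of_nat)"
    by (intro inj_compose inj_single)
  then show ?thesis by (rule range_inj_infinite[THEN infinite_super[OF subset_UNIV]])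
qed

lemma torsion_closure:
  fixes M :: "(('v::finite, 'a::comm_ring_1) mpolynomial, 'b) graded_module" (structure)
  assumes "graded_module M" "ideal I poly_ring"
  shows "\<zero> \<in> torsion I M" "x \<in> torsion I M \<Longrightarrow> y \<in> torsion I M \<Longrightarrow> x \<oplus> y \<in> torsion I M"
    "x \<in> torsion I M \<Longrightarrow> p \<odot> x \<in> torsion I M"
proof -
  interpret graded_module M by fact
  show "\<zero> \<in> torsion I M" by (simp add: torsion_def)
  show "x \<oplus> y \<in> torsion I M" if xy: "x \<in> torsion I M" "y \<in> torsion I M" 
  proof -
    from xy obtain s t :: nat where
      s: "x \<in> carrier M" "\<And>p. p \<in> I [^]\<^bsub>ideals_set poly_ring\<^esub> s \<Longrightarrow> p \<odot> x = \<zero>" and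
      t: "y \<in> carrier M" "\<And>p. p \<in> I [^]\<^bsub>ideals_set poly_ring\<^esub> t \<Longrightarrow> p \<odot> y = \<zero>"
      by (auto simp: torsion_def)
    have "p \<odot> (x \<oplus> y) = \<zero>" if "p \<in> I [^]\<^bsub>ideals_set poly_ring\<^esub> max s t" for p
    proof -
      have "p \<in> I [^]\<^bsub>ideals_set poly_ring\<^esub> s" "p \<in> I [^]\<^bsub>ideals_set poly_ring\<^esub> t"
        using that ideal_power_antimono[OF assms(2), of _ "max s t"] by (meson max.cobounded1 max.cobounded2 subsetD)+
      then show ?thesis using s t by (simp add: scalar_distribs)
    qed
    then show ?thesis using s(1) t(1) by (auto simp: torsion_def)
  qed
  show "p \<odot> x \<in> torsion I M" if x: "x \<in> torsion I M"
  proof -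
    from x obtain t :: nat where
      t: "x \<in> carrier M" "\<And>p. p \<in> I [^]\<^bsub>ideals_set poly_ring\<^esub> t \<Longrightarrow> p \<odot> x = \<zero>"
      by (auto simp: torsion_def)
    have "q \<odot> (p \<odot> x) = \<zero>" if "q \<in> I [^]\<^bsub>ideals_set poly_ring\<^esub> t" for q
    proof -
      have "q \<odot> (p \<odot> x) = p \<odot> (q \<odot> x)" using t(1) by (simp add: mult.commute flip: scalar_distribs)
      then show ?thesis using t(2)[OF that] by simp
    qed
    then show ?thesis using t(1) by (auto simp: torsion_def)
  qed
qed

lemma torsion_graded_hom:
  assumes "graded_module M" "graded_module N" "h \<in> graded_hom M N" "x \<in> torsion I M"
  shows "h x \<in> torsion I N"
proof -
  note h = graded_homD[OF assms(3)] graded_hom_zero[OF assms(1-3)]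
  from assms(4) obtain t :: nat where
    t: "x \<in> carrier M" "\<And>p. p \<in> I [^]\<^bsub>ideals_set poly_ring\<^esub> t \<Longrightarrow> p \<odot>\<^bsub>M\<^esub> x = \<zero>\<^bsub>M\<^esub>"
    by (auto simp: torsion_def)
  have "p \<odot>\<^bsub>N\<^esub> h x = \<zero>\<^bsub>N\<^esub>" if "p \<in> I [^]\<^bsub>ideals_set poly_ring\<^esub> t" for p
    using h(3)[OF t(1), of p] t(2)[OF that] h(5) by simp
  then show ?thesis using h(1) t(1) by (auto simp: torsion_def)
qed

text \<open>
  If \<open>I\<^sup>t x = 0\<close>, then \<open>p \<theta> x = \<theta> (p x) - \<delta> p x = 0\<close> for \<open>p \<in> I\<^bsup>t+1\<^esup>\<close>, because \<open>\<delta>\<close> maps \<open>I\<^bsup>t+1\<^esup>\<close> into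
  \<open>I\<^sup>t\<close>.
\<close>

lemma torsion_connection:
  assumes "graded_module M" "ideal I poly_ring" "derivation \<delta> k" "connection \<delta> k M \<theta>" "x \<in> torsion I M"
  shows "\<theta> x \<in> torsion I M"
proof -
  interpret graded_module M by fact
  note \<theta> = connectionD[OF assms(4)]
  from assms(5) obtain t :: nat where
    t: "x \<in> carrier M" "\<And>p. p \<in> I [^]\<^bsub>ideals_set poly_ring\<^esub> t \<Longrightarrow> p \<odot>\<^bsub>M\<^esub> x = \<zero>\<^bsub>M\<^esub>"
    by (auto simp: torsion_def)
  have "\<theta> \<zero>\<^bsub>M\<^esub> = \<zero>\<^bsub>M\<^esub>" using \<theta>(3)[of "\<zero>\<^bsub>M\<^esub>" 0] \<theta>(1)[of "\<zero>\<^bsub>M\<^esub>"] by simp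
  moreover have "p \<odot>\<^bsub>M\<^esub> x = \<zero>\<^bsub>M\<^esub>" "\<delta> p \<odot>\<^bsub>M\<^esub> x = \<zero>\<^bsub>M\<^esub>"
    if "p \<in> I [^]\<^bsub>ideals_set poly_ring\<^esub> Suc t" for p
    using that t(2) derivation_ideal_power[OF assms(2,3)] ideal_power_antimono[OF assms(2), of t "Suc t"] by auto
  ultimately have "p \<odot>\<^bsub>M\<^esub> \<theta> x = \<zero>\<^bsub>M\<^esub>" if "p \<in> I [^]\<^bsub>ideals_set poly_ring\<^esub> Suc t" for p
    using that \<theta>(3)[OF t(1), of p] \<theta>(1)[OF t(1)] by simp
  then show ?thesis using \<theta>(1) t(1) unfolding torsion_def by blast
qed

lemma (in graded_module) sum_scalar:
  assumes "x \<in> carrier M" "finite S"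
  shows "(\<Sum>v\<in>S. p v) \<odot> x = (\<Oplus>v\<in>S. p v \<odot> x)"
  using assms(2)
  by induction (use assms(1) in \<open>auto simp: scalar_distribs\<close>)

lemma (in graded_module) finsum_grade:
  assumes "finite S" "\<And>v. v \<in> S \<Longrightarrow> c v \<in> grade M n"
  shows "finsum M c S \<in> grade M n"
  using assms
proof induction
  case (insert a S)
  then have "c \<in> S \<rightarrow> carrier M" "c a \<in> carrier M" using grade_carrier by blast+
  then show ?case using insert by (simp add: grade.a_closed)
qed (simp add: grade.zero_closed)

text \<open>
  Both operators satisfy the Leibniz rule for the Euler derivation, so the derivation terms cancel in
  the difference.
\<close>

lemma euler_defect_graded_hom:
  fixes M :: "(('v::finite, 'a::comm_ring_1) mpolynomial, 'b) graded_module"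
  assumes "graded_module M" and \<theta>: "\<And>v. connection (partial v) (- 1) M (\<theta> v)"
  shows "(\<lambda>x. (\<Oplus>\<^bsub>M\<^esub>v\<in>UNIV. var v \<odot>\<^bsub>M\<^esub> \<theta> v x) \<ominus>\<^bsub>M\<^esub> degree_operator M x) \<in> graded_hom M M"
proof -
  interpret graded_module M by fact
  note \<theta>D = connectionD[OF \<theta>]
  let ?e = "\<lambda>x. \<Oplus>\<^bsub>M\<^esub>v\<in>UNIV. var v \<odot>\<^bsub>M\<^esub> \<theta> v x"
  have closed: "?e x \<in> carrier M" if "x \<in> carrier M" for x
    using that by (intro M.finsum_closed) (auto simp: \<theta>D)
  have e_add: "?e (x \<oplus>\<^bsub>M\<^esub> y) = ?e x \<oplus>\<^bsub>M\<^esub> ?e y" if xy: "x \<in> carrier M" "y \<in> carrier M" for x y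
  proof -
    have "?e (x \<oplus>\<^bsub>M\<^esub> y) = (\<Oplus>\<^bsub>M\<^esub>v\<in>UNIV. var v \<odot>\<^bsub>M\<^esub> \<theta> v x \<oplus>\<^bsub>M\<^esub> var v \<odot>\<^bsub>M\<^esub> \<theta> v y)"
      using xy by (intro M.finsum_cong') (auto simp: \<theta>D scalar_distribs)
    then show ?thesis using xy by (simp add: M.finsum_addf \<theta>D Pi_def)
  qed
  have e_smult: "?e (p \<odot>\<^bsub>M\<^esub> x) = p \<odot>\<^bsub>M\<^esub> ?e x \<oplus>\<^bsub>M\<^esub> (\<Sum>v\<in>UNIV. var v * partial v p) \<odot>\<^bsub>M\<^esub> x"
    if x: "x \<in> carrier M" for p x
  proof -
    have "var v \<odot>\<^bsub>M\<^esub> \<theta> v (p \<odot>\<^bsub>M\<^esub> x) = p \<odot>\<^bsub>M\<^esub> (var v \<odot>\<^bsub>M\<^esub> \<theta> v x) \<oplus>\<^bsub>M\<^esub> (var v * partial v p) \<odot>\<^bsub>M\<^esub> x" for v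
      using x scalar_distribs(2)[of "\<theta> v x" p "var v"] scalar_distribs(2)[of "\<theta> v x" "var v" p]
      by (simp add: \<theta>D scalar_distribs mult.commute)
    then have "?e (p \<odot>\<^bsub>M\<^esub> x) = (\<Oplus>\<^bsub>M\<^esub>v\<in>UNIV. p \<odot>\<^bsub>M\<^esub> (var v \<odot>\<^bsub>M\<^esub> \<theta> v x) \<oplus>\<^bsub>M\<^esub> (var v * partial v p) \<odot>\<^bsub>M\<^esub> x)"
      by simp
    also have "\<dots> = (\<Oplus>\<^bsub>M\<^esub>v\<in>UNIV. p \<odot>\<^bsub>M\<^esub> (var v \<odot>\<^bsub>M\<^esub> \<theta> v x)) \<oplus>\<^bsub>M\<^esub> (\<Oplus>\<^bsub>M\<^esub>v\<in>UNIV. (var v * partial v p) \<odot>\<^bsub>M\<^esub> x)"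
      using x by (intro M.finsum_addf) (auto simp: \<theta>D)
    also have "(\<Oplus>\<^bsub>M\<^esub>v\<in>UNIV. p \<odot>\<^bsub>M\<^esub> (var v \<odot>\<^bsub>M\<^esub> \<theta> v x)) = p \<odot>\<^bsub>M\<^esub> ?e x"
      using x finsum_smult_ldistr[of UNIV p "\<lambda>v. var v \<odot>\<^bsub>M\<^esub> \<theta> v x"] by (simp add: \<theta>D Pi_def)
    finally show ?thesis using x by (simp add: sum_scalar)
  qed
  show ?thesis
    unfolding graded_hom_def
  proof (intro CollectI conjI ballI allI Pi_I subsetI, goal_cases)
    case (1 x)
    then show ?case by (simp add: closed)
  next
    case (2 x y)
    then show ?case
      by (simp add: e_add degree_operator_add closed M.minus_eq M.minus_add M.a_ac)
  next
    case (3 p x)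
    then show ?case
      by (simp add: e_smult degree_operator_smult closed M.minus_add_cancel_right)
        (simp add: M.minus_eq scalar_distribs smult_r_minus closed)
  next
    case (4 n y)
    then obtain x where x: "x \<in> grade M n" and y: "y = ?e x \<ominus>\<^bsub>M\<^esub> degree_operator M x" by blast
    have "var v \<odot>\<^bsub>M\<^esub> \<theta> v x \<in> grade M n" for v
      using grade_smult[OF var_homogeneous \<theta>D(4)[OF x], of v v] by simp
    then have "?e x \<in> grade M n" by (intro finsum_grade) auto
    then show ?case unfolding y M.minus_eq
      using degree_operator_grade[OF x] by (intro grade.a_closed grade.a_inv_closed)
  qed
qed

section \<open>Cohomology as a module over the Weyl algebra\<close>

context graded_resolution
begin

lemma coboundaries_closure:
  assumes "ideal I poly_ring"
  shows "x \<in> coboundaries I E d i \<Longrightarrow> x \<in> carrier (E i)"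
    "\<zero>\<^bsub>E i\<^esub> \<in> coboundaries I E d i"
    "x \<in> coboundaries I E d i \<Longrightarrow> y \<in> coboundaries I E d i \<Longrightarrow> x \<oplus>\<^bsub>E i\<^esub> y \<in> coboundaries I E d i"
    "x \<in> coboundaries I E d i \<Longrightarrow> p \<odot>\<^bsub>E i\<^esub> x \<in> coboundaries I E d i"
proof -
  note T = torsion_closure[OF graded assms]
  have carr: "x \<in> torsion I (E i) \<Longrightarrow> x \<in> carrier (E i)" for x i by (simp add: torsion_def)
  show "x \<in> coboundaries I E d i \<Longrightarrow> x \<in> carrier (E i)"
    by (cases i) (auto simp: coboundaries_def carr d)
  show "\<zero>\<^bsub>E i\<^esub> \<in> coboundaries I E d i"
  proof (cases i)
    case (Suc j)
    then show ?thesis using d_zero[of j] imageI[OF T(1), of "d j" j] by (simp add: coboundaries_def)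
  qed (simp add: coboundaries_def)
  show "x \<oplus>\<^bsub>E i\<^esub> y \<in> coboundaries I E d i" if xy: "x \<in> coboundaries I E d i" "y \<in> coboundaries I E d i"
  proof (cases i)
    case (Suc j)
    with xy obtain a b where "x = d j a" "y = d j b" "a \<in> torsion I (E j)" "b \<in> torsion I (E j)"
      by (auto simp: coboundaries_def)
    then show ?thesis using Suc T(2)[of a j b] by (simp add: coboundaries_def carr flip: d(2))
  qed (use xy in \<open>simp add: coboundaries_def\<close>)
  show "p \<odot>\<^bsub>E i\<^esub> x \<in> coboundaries I E d i" if x: "x \<in> coboundaries I E d i"
  proof (cases i)
    case (Suc j)
    with x obtain a where "x = d j a" "a \<in> torsion I (E j)"
      by (auto simp: coboundaries_def)
    then show ?thesis using Suc T(3)[of a j p] by (simp add: coboundaries_def carr flip: d(3))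
  qed (use x in \<open>simp add: coboundaries_def\<close>)
qed

lemma coboundaries_finsum:
  assumes "ideal I poly_ring" "finite S" "\<And>v. v \<in> S \<Longrightarrow> c v \<in> coboundaries I E d i"
  shows "finsum (E i) c S \<in> coboundaries I E d i"
  using assms(2,3)
proof induction
  case (insert a S)
  then have "c \<in> S \<rightarrow> carrier (E i)" "c a \<in> carrier (E i)" using coboundaries_closure(1)[OF assms(1)] by blast+
  then show ?case using insert by (simp add: coboundaries_closure[OF assms(1)])
qed (simp add: coboundaries_closure[OF assms(1)])

lemma coboundaries_minus:
  assumes "ideal I poly_ring" "x \<in> coboundaries I E d i" "y \<in> coboundaries I E d i"
  shows "x \<ominus>\<^bsub>E i\<^esub> y \<in> coboundaries I E d i"
  using assms coboundaries_closure[OF assms(1)] by (simp add: E.M.minus_eq E.minus_eq_scalar)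

lemma cocycles_carrier: "z \<in> cocycles I E d i \<Longrightarrow> z \<in> carrier (E i)"
  by (simp add: cocycles_def torsion_def)

lemma cocycles_smult:
  assumes "ideal I poly_ring" "z \<in> cocycles I E d i"
  shows "p \<odot>\<^bsub>E i\<^esub> z \<in> cocycles I E d i"
  using assms(2) torsion_closure(3)[OF graded assms(1)] cocycles_carrier[OF assms(2)]
  by (simp add: cocycles_def d)

lemma connection_cocycles:
  assumes "ideal I poly_ring" "derivation \<delta> k"
    and \<theta>: "\<And>i. connection \<delta> k (E i) (\<theta> i)" "\<And>i x. x \<in> carrier (E i) \<Longrightarrow> \<theta> (Suc i) (d i x) = d i (\<theta> i x)"
  shows "z \<in> cocycles I E d i \<Longrightarrow> \<theta> i z \<in> cocycles I E d i"
    and "z \<in> coboundaries I E d i \<Longrightarrow> \<theta> i z \<in> coboundaries I E d i"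
proof -
  have zero: "\<theta> i \<zero>\<^bsub>E i\<^esub> = \<zero>\<^bsub>E i\<^esub>" for i
    using connectionD(3)[OF \<theta>(1)[of i], of "\<zero>\<^bsub>E i\<^esub>" 0] connectionD(1)[OF \<theta>(1)[of i], of "\<zero>\<^bsub>E i\<^esub>"] by simp
  note tors = torsion_connection[OF graded assms(1,2) \<theta>(1)]
  show "\<theta> i z \<in> cocycles I E d i" if z: "z \<in> cocycles I E d i"
    using z tors \<theta>(2)[OF cocycles_carrier[OF z], symmetric] zero by (simp add: cocycles_def)
  show "\<theta> i z \<in> coboundaries I E d i" if z: "z \<in> coboundaries I E d i"
  proof (cases i)
    case (Suc j)
    with z obtain a where a: "z = d j a" "a \<in> torsion I (E j)" by (auto simp: coboundaries_def)
    then have "\<theta> i z = d j (\<theta> j a)" using \<theta>(2) Suc by (simp add: torsion_def)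
    then show ?thesis using tors[OF a(2)] Suc by (auto simp: coboundaries_def)
  qed (use z zero in \<open>simp add: coboundaries_def\<close>)
qed

end

text \<open>
  The lifts \<open>\<theta>\<^sub>v\<close> of different partial derivatives commute only up to homotopy, but the Weyl relation
  \<open>\<theta>\<^sub>v X\<^sub>v = X\<^sub>v \<theta>\<^sub>v + 1\<close> holds on the nose by the Leibniz rule.
\<close>

locale resolution_with_partials = graded_resolution \<epsilon> E d
  for \<epsilon> :: "('v::finite, 'a::comm_ring_1) mpolynomial \<Rightarrow> 'e"
    and E :: "nat \<Rightarrow> (('v, 'a) mpolynomial, 'e) graded_module"
    and d :: "nat \<Rightarrow> 'e \<Rightarrow> 'e" +
  fixes \<theta> :: "'v \<Rightarrow> nat \<Rightarrow> 'e \<Rightarrow> 'e"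
    and I :: "('v, 'a) mpolynomial set"
  assumes \<theta>: "connection (partial v) (- 1) (E i) (\<theta> v i)"
    and \<theta>_d: "x \<in> carrier (E i) \<Longrightarrow> \<theta> v (Suc i) (d i x) = d i (\<theta> v i x)"
    and \<theta>_eps: "\<theta> v 0 (\<epsilon> p) = \<epsilon> (partial v p)"
    and ideal: "ideal I poly_ring"
begin

lemmas \<theta>D = connectionD[OF \<theta>]

text \<open>
  The difference \<open>\<phi>\<close> of the Euler operator and the degree operator lifts the zero map of \<open>R\<close>, so on cycles
  \<open>\<phi> = d h\<close> with \<open>h\<close> \<open>R\<close>-linear. As \<open>h\<close> preserves torsion, \<open>\<phi>\<close> maps cocycles to coboundaries.
\<close>

lemma euler_on_cocycles:
  assumes z: "z \<in> cocycles I E d i" and z_deg: "z \<in> grade (E i) n"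
  shows "(\<Oplus>\<^bsub>E i\<^esub>v\<in>UNIV. var v \<odot>\<^bsub>E i\<^esub> \<theta> v i z) \<ominus>\<^bsub>E i\<^esub> of_int n \<odot>\<^bsub>E i\<^esub> z \<in> coboundaries I E d i"
proof -
  let ?e = "\<lambda>i x. \<Oplus>\<^bsub>E i\<^esub>v\<in>UNIV. var v \<odot>\<^bsub>E i\<^esub> \<theta> v i x"
  define \<phi> where "\<phi> = (\<lambda>i x. ?e i x \<ominus>\<^bsub>E i\<^esub> degree_operator (E i) x)"
  have e_closed: "?e i x \<in> carrier (E i)" if "x \<in> carrier (E i)" for i x
    using that by (intro E.M.finsum_closed) (auto simp: \<theta>D)
  have \<phi>: "\<phi> i \<in> graded_hom (E i) (E i)" for i
    unfolding \<phi>_def by (rule euler_defect_graded_hom[OF graded \<theta>])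
  have d_sum: "d i (finsum (E i) c UNIV) = (\<Oplus>\<^bsub>E (Suc i)\<^esub>v\<in>UNIV. d i (c v))"
    if "\<And>v. c v \<in> carrier (E i)" for i and c :: "'v \<Rightarrow> 'e"
    using that d by (intro additive_map_finsum(2)[OF E.M.abelian_group_axioms E.M.abelian_group_axioms]) auto
  have d_minus: "d i (x \<ominus>\<^bsub>E i\<^esub> y) = d i x \<ominus>\<^bsub>E (Suc i)\<^esub> d i y"
    if "x \<in> carrier (E i)" "y \<in> carrier (E i)" for i x y
    using that by (simp add: E.M.minus_eq E.minus_eq_scalar d)
  have comm: "\<phi> (Suc i) (d i x) = d i (\<phi> i x)" if x: "x \<in> carrier (E i)" for i x
    using x by (simp add: \<phi>_def d_minus e_closed d_sum \<theta>D \<theta>_d d graded_hom_degree_operator[OF graded graded differential])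
  have zero: "\<phi> 0 (\<epsilon> p) = \<zero>\<^bsub>E 0\<^esub>" for p
  proof -
    define \<psi> where "\<psi> = (\<lambda>p. \<phi> 0 (\<epsilon> p))"
    have add: "\<psi> (p + q) = \<psi> p \<oplus>\<^bsub>E 0\<^esub> \<psi> q" for p q
      using eps graded_homD[OF \<phi>] by (simp add: \<psi>_def)
    have "\<psi> p = \<zero>\<^bsub>E 0\<^esub>"
    proof (induction p rule: mpolynomial_induct)
      case (monomial t a)
      define q where "q = Poly_Mapping.single t a"
      define k where "k = int (monomial_degree t)"
      have q: "q \<in> grade poly_graded k" unfolding q_def k_def by (rule monomial_homogeneous)
      have eps_sum: "\<epsilon> (\<Sum>v\<in>S. c v) = finsum (E 0) (\<lambda>v. \<epsilon> (c v)) S" if "finite S"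
        for S :: "'v set" and c :: "'v \<Rightarrow> ('v, 'a) mpolynomial"
        using that
      proof induction
        case empty
        show ?case using graded_hom_zero[OF poly_graded_module graded augmentation] by simp
      next
        case (insert a S)
        then show ?case by (simp add: eps)
      qed
      have "?e 0 (\<epsilon> q) = (\<Oplus>\<^bsub>E 0\<^esub>v\<in>UNIV. \<epsilon> (var v * partial v q))"
        by (simp add: \<theta>_eps eps)
      also have "\<dots> = \<epsilon> (of_int k * q)"
        using eps_sum[of UNIV "\<lambda>v. var v * partial v q"] euler_formula[OF q] by simp
      also have "\<dots> = degree_operator (E 0) (\<epsilon> q)"
        using E.degree_operator_homogeneous[OF eps(4)[OF q]] by (simp add: eps)
      finally have "\<psi> q = \<zero>\<^bsub>E 0\<^esub>" by (simp add: \<psi>_def \<phi>_def eps E.M.minus_eq E.M.r_neg)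
      then show ?case by (simp add: q_def)
    qed (simp add: add)
    then show ?thesis by (simp add: \<psi>_def)
  qed
  have "\<phi> i z \<in> coboundaries I E d i"
  proof (cases i)
    case 0
    then show ?thesis using null_homotopy(1)[of \<phi>, OF \<phi> comm zero, of z] z cocycles_carrier[OF z]
      by (simp add: coboundaries_def cocycles_def)
  next
    case (Suc j)
    obtain h where h: "h \<in> graded_hom (E (Suc j)) (E j)"
      "\<And>x. x \<in> carrier (E (Suc j)) \<Longrightarrow> d (Suc j) x = \<zero>\<^bsub>E (Suc (Suc j))\<^esub> \<Longrightarrow> \<phi> (Suc j) x = d j (h x)"
      using null_homotopy(2)[of \<phi>, OF \<phi> comm zero, of j] by blast
    have "h z \<in> torsion I (E j)"
      using z Suc by (intro torsion_graded_hom[OF graded graded h(1)]) (simp add: cocycles_def)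
    moreover have "\<phi> i z = d j (h z)"
      using h(2)[of z] z Suc cocycles_carrier[OF z] by (simp add: cocycles_def)
    ultimately show ?thesis using Suc by (simp add: coboundaries_def)
  qed
  then show ?thesis by (simp add: \<phi>_def E.degree_operator_homogeneous[OF z_deg])
qed

lemma coboundary_cancel:
  assumes "z \<in> carrier (E i)" "c * r = 1" "r \<odot>\<^bsub>E i\<^esub> z \<in> coboundaries I E d i"
  shows "z \<in> coboundaries I E d i"
  using coboundaries_closure(4)[OF ideal assms(3), of c] assms(1,2) by (simp flip: E.scalar_distribs(2))

text \<open>
  In \<open>(n + 1) z = \<Sum> X\<^sub>v \<theta>\<^sub>v z\<close>, up to coboundaries, all \<open>\<theta>\<^sub>v z\<close> have degree \<open>n\<close>.
\<close>

lemma vanishing_up: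
  assumes vanish: "cocycles I E d i \<inter> grade (E i) n \<subseteq> coboundaries I E d i"
    and inv: "c * (of_int (n + 1) :: ('v, 'a) mpolynomial) = 1"
  shows "cocycles I E d i \<inter> grade (E i) (n + 1) \<subseteq> coboundaries I E d i"
proof
  fix z assume "z \<in> cocycles I E d i \<inter> grade (E i) (n + 1)"
  then have z: "z \<in> cocycles I E d i" "z \<in> grade (E i) (n + 1)" by auto
  have zc: "z \<in> carrier (E i)" by (rule cocycles_carrier[OF z(1)])
  let ?e = "\<Oplus>\<^bsub>E i\<^esub>v\<in>UNIV. var v \<odot>\<^bsub>E i\<^esub> \<theta> v i z"
  have "\<theta> v i z \<in> coboundaries I E d i" for v
    using vanish \<theta>D(4)[OF z(2), of v] connection_cocycles(1)[OF ideal derivation_partial \<theta> \<theta>_d z(1)] by auto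
  then have e: "?e \<in> coboundaries I E d i"
    by (intro coboundaries_finsum ideal coboundaries_closure(4)) auto
  have "?e \<ominus>\<^bsub>E i\<^esub> (?e \<ominus>\<^bsub>E i\<^esub> of_int (n + 1) \<odot>\<^bsub>E i\<^esub> z) \<in> coboundaries I E d i"
    by (intro coboundaries_minus ideal e euler_on_cocycles z)
  moreover have "u \<ominus>\<^bsub>E i\<^esub> (u \<ominus>\<^bsub>E i\<^esub> w) = w" if "u \<in> carrier (E i)" "w \<in> carrier (E i)" for u w
    using that by (simp add: E.M.minus_eq E.M.minus_add E.M.r_neg2 E.M.minus_minus)
  ultimately have "of_int (n + 1) \<odot>\<^bsub>E i\<^esub> z \<in> coboundaries I E d i"
    using coboundaries_closure(1)[OF ideal e] zc by (simp del: of_int_add)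
  then show "z \<in> coboundaries I E d i" by (rule coboundary_cancel[OF zc inv])
qed

text \<open>
  In \<open>(m + n - 1) z = \<Sum> \<theta>\<^sub>v (X\<^sub>v z)\<close>, up to coboundaries, all \<open>X\<^sub>v z\<close> have degree \<open>n\<close>. The summand \<open>m\<close>
  comes from \<open>\<theta>\<^sub>v (X\<^sub>v z) = X\<^sub>v \<theta>\<^sub>v z + z\<close>.
\<close>

lemma vanishing_down:
  assumes vanish: "cocycles I E d i \<inter> grade (E i) n \<subseteq> coboundaries I E d i"
    and inv: "c * (of_int (int CARD('v) + n - 1) :: ('v, 'a) mpolynomial) = 1"
  shows "cocycles I E d i \<inter> grade (E i) (n - 1) \<subseteq> coboundaries I E d i"
proof
  fix z assume "z \<in> cocycles I E d i \<inter> grade (E i) (n - 1)"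
  then have z: "z \<in> cocycles I E d i" "z \<in> grade (E i) (n - 1)" by auto
  have zc: "z \<in> carrier (E i)" by (rule cocycles_carrier[OF z(1)])
  let ?e = "\<Oplus>\<^bsub>E i\<^esub>v\<in>UNIV. var v \<odot>\<^bsub>E i\<^esub> \<theta> v i z" and ?w = "\<Oplus>\<^bsub>E i\<^esub>v\<in>UNIV. \<theta> v i (var v \<odot>\<^bsub>E i\<^esub> z)"
  have "var v \<odot>\<^bsub>E i\<^esub> z \<in> coboundaries I E d i" for v
    using vanish E.grade_smult[OF var_homogeneous z(2), of v] cocycles_smult[OF ideal z(1)] by auto
  then have w: "?w \<in> coboundaries I E d i"
    using connection_cocycles(2)[OF ideal derivation_partial \<theta> \<theta>_d]
    by (intro coboundaries_finsum ideal) auto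
  have ec: "?e \<in> carrier (E i)" using zc by (intro E.M.finsum_closed) (auto simp: \<theta>D)
  have "?w = (\<Oplus>\<^bsub>E i\<^esub>v\<in>UNIV. var v \<odot>\<^bsub>E i\<^esub> \<theta> v i z \<oplus>\<^bsub>E i\<^esub> 1 \<odot>\<^bsub>E i\<^esub> z)"
    using zc by (intro E.M.finsum_cong') (auto simp: \<theta>D partial_var)
  also have "\<dots> = ?e \<oplus>\<^bsub>E i\<^esub> (\<Oplus>\<^bsub>E i\<^esub>v\<in>(UNIV::'v set). 1 \<odot>\<^bsub>E i\<^esub> z)"
    using zc by (intro E.M.finsum_addf) (auto simp: \<theta>D)
  also have "(\<Oplus>\<^bsub>E i\<^esub>v\<in>(UNIV::'v set). 1 \<odot>\<^bsub>E i\<^esub> z) = of_nat CARD('v) \<odot>\<^bsub>E i\<^esub> z"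
    using E.sum_scalar[OF zc, of "UNIV :: 'v set" "\<lambda>_. 1"] by simp
  finally have w_eq: "?w = ?e \<oplus>\<^bsub>E i\<^esub> of_nat CARD('v) \<odot>\<^bsub>E i\<^esub> z" .
  have "?w \<ominus>\<^bsub>E i\<^esub> (?e \<ominus>\<^bsub>E i\<^esub> of_int (n - 1) \<odot>\<^bsub>E i\<^esub> z) \<in> coboundaries I E d i"
    by (intro coboundaries_minus ideal w euler_on_cocycles z)
  moreover have "(u \<oplus>\<^bsub>E i\<^esub> y) \<ominus>\<^bsub>E i\<^esub> (u \<ominus>\<^bsub>E i\<^esub> x) = y \<oplus>\<^bsub>E i\<^esub> x"
    if "u \<in> carrier (E i)" "x \<in> carrier (E i)" "y \<in> carrier (E i)" for u x y
    using that E.M.a_comm[OF that(1,3)]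
    by (simp add: E.M.minus_eq E.M.minus_add E.M.minus_minus E.M.a_assoc E.M.r_neg2)
  ultimately have "of_nat CARD('v) \<odot>\<^bsub>E i\<^esub> z \<oplus>\<^bsub>E i\<^esub> of_int (n - 1) \<odot>\<^bsub>E i\<^esub> z \<in> coboundaries I E d i"
    using ec zc by (simp add: w_eq)
  then have "of_int (int CARD('v) + n - 1) \<odot>\<^bsub>E i\<^esub> z \<in> coboundaries I E d i"
    using E.scalar_distribs(1)[OF zc, of "of_nat CARD('v)" "of_int (n - 1)"] by (simp add: add_diff_eq)
  then show "z \<in> coboundaries I E d i" by (rule coboundary_cancel[OF zc inv])
qed

end

section \<open>Rigidity of the graded components\<close>

text \<open>
  The vanishing of a graded component, a statement about cosets, in terms of homogeneous representatives.
\<close>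

lemma (in graded_resolution) local_cohomology_grade_trivial_iff:
  assumes "ideal I poly_ring"
  shows "grade (local_cohomology I E d i) n = {\<zero>\<^bsub>local_cohomology I E d i\<^esub>} \<longleftrightarrow>
    cocycles I E d i \<inter> grade (E i) n \<subseteq> coboundaries I E d i"
proof -
  let ?B = "coboundaries I E d i" and ?Z = "cocycles I E d i"
  note B = coboundaries_closure[OF assms]
  have sub: "subgroup ?B (add_monoid (E i))"
  proof (rule E.M.add.subgroupI)
    show "\<ominus>\<^bsub>E i\<^esub> x \<in> ?B" if "x \<in> ?B" for x
      using B(4)[OF that, of "- 1"] E.minus_eq_scalar[OF B(1)[OF that]] by simp
  qed (use B(1)[of _ i] B(2)[of i] B(3)[of _ i] in auto)
  have coset: "?B +>\<^bsub>E i\<^esub> z = ?B \<longleftrightarrow> z \<in> ?B" if "z \<in> ?Z" for z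
    using E.M.a_coset_join1[OF _ _ sub] E.M.a_coset_join2[OF _ sub] cocycles_carrier[OF that] by blast
  have "\<zero>\<^bsub>E i\<^esub> \<in> ?Z \<inter> grade (E i) n"
    using torsion_closure(1)[OF graded assms] by (simp add: cocycles_def d_zero E.grade.zero_closed)
  then have "?Z \<inter> grade (E i) n \<noteq> {}" by blast
  then have "(\<lambda>z. ?B +>\<^bsub>E i\<^esub> z) ` (?Z \<inter> grade (E i) n) = {?B} \<longleftrightarrow>
    (\<forall>z\<in>?Z \<inter> grade (E i) n. ?B +>\<^bsub>E i\<^esub> z = ?B)" by blast
  also have "\<dots> \<longleftrightarrow> (\<forall>z\<in>?Z \<inter> grade (E i) n. z \<in> ?B)"
    using coset by (intro ball_cong) auto
  finally show ?thesis by (simp add: local_cohomology_def Let_def subset_eq)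
qed

theorem theorem1p3:
  fixes K :: "'a::comm_ring_1 set"
    and I :: "('v::finite, 'a) mpolynomial set"
    and \<epsilon> :: "('v, 'a) mpolynomial \<Rightarrow> 'e"
    and E :: "nat \<Rightarrow> (('v, 'a) mpolynomial, 'e) graded_module"
    and d :: "nat \<Rightarrow> 'e \<Rightarrow> 'e"
    and i :: nat
  assumes "noetherian_ring (ring_of_type_algebra :: 'a ring)"
    and "subfield K (ring_of_type_algebra :: 'a ring)"
    and "CHAR('a) = 0"
    and "homogeneous_ideal I"
    and "graded_injective_resolution \<epsilon> E d"
  defines "M \<equiv> local_cohomology I E d i"
  shows "(infinite {n::int. n < 0 \<and> grade M n \<noteq> {\<zero>\<^bsub>M\<^esub>}} \<longleftrightarrow>
            (\<forall>n::int. n \<le> - int CARD('v) \<longrightarrow> grade M n \<noteq> {\<zero>\<^bsub>M\<^esub>})) \<and>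
         (infinite {n::int. n > 0 \<and> grade M n \<noteq> {\<zero>\<^bsub>M\<^esub>}} \<longleftrightarrow>
            (\<forall>n::int. n \<ge> 0 \<longrightarrow> grade M n \<noteq> {\<zero>\<^bsub>M\<^esub>}))"
proof -
  interpret graded_resolution \<epsilon> E d by unfold_locales fact
  have ideal: "ideal I poly_ring" using assms(4) by (simp add: homogeneous_ideal_def)
  (* The resolution contains R, which is infinite in characteristic zero; hence so is its element type. *)
  have "infinite (range \<epsilon>)"
    using infinite_mpolynomial[OF assms(3)] augmentation_inj finite_imageD by blast
  then have inf: "infinite (UNIV :: 'e set)" by (rule infinite_super[OF subset_UNIV])
  have "\<forall>v. \<exists>\<theta>. (\<forall>i. connection (partial v) (- 1) (E i) (\<theta> i)) \<and>
      (\<forall>i. \<forall>x\<in>carrier (E i). \<theta> (Suc i) (d i x) = d i (\<theta> i x)) \<and> (\<forall>p. \<theta> 0 (\<epsilon> p) = \<epsilon> (partial v p))"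
    using lift_derivation[OF inf derivation_partial] by metis
  then obtain \<theta> where \<theta>: "\<And>v. (\<forall>i. connection (partial v) (- 1) (E i) (\<theta> v i)) \<and>
      (\<forall>i. \<forall>x\<in>carrier (E i). \<theta> v (Suc i) (d i x) = d i (\<theta> v i x)) \<and> (\<forall>p. \<theta> v 0 (\<epsilon> p) = \<epsilon> (partial v p))"
    by metis
  interpret resolution_with_partials \<epsilon> E d \<theta> I
    by (intro resolution_with_partials.intro resolution_with_partials_axioms.intro graded_resolution_axioms ideal)
      (use \<theta> in auto)
  have inv: "\<exists>c. c * (of_int n :: ('v, 'a) mpolynomial) = 1" if "n \<noteq> 0" for n
  proof -
    obtain c :: 'a where "c * of_int n = 1" using of_int_invertible[OF assms(2,3) \<open>n \<noteq> 0\<close>] by blast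
    then have "Poly_Mapping.single 0 c * (of_int n :: ('v, 'a) mpolynomial) = 1"
      by (simp add: mult_single flip: single_of_int single_one)
    then show ?thesis by blast
  qed
  define Z where "Z n \<longleftrightarrow> grade M n = {\<zero>\<^bsub>M\<^esub>}" for n
  have Z_iff: "Z n \<longleftrightarrow> cocycles I E d i \<inter> grade (E i) n \<subseteq> coboundaries I E d i" for n
    unfolding Z_def M_def by (rule local_cohomology_grade_trivial_iff[OF ideal])
  have up: "Z (n + 1)" if "Z n" "n \<ge> 0" for n
    using vanishing_up inv[of "n + 1"] that unfolding Z_iff by force
  have down: "Z (n - 1)" if "Z n" "n \<le> - int CARD('v)" for n
    using vanishing_down inv[of "int CARD('v) + n - 1"] that unfolding Z_iff by force
  have up_all: "Z k" if "Z n" "n \<ge> 0" "k \<ge> n" for n k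
    using that(3) by (induction k rule: int_ge_induct) (use that(1,2) up in auto)
  have down_all: "Z k" if "Z n" "n \<le> - int CARD('v)" "k \<le> n" for n k
    using that(3) by (induction k rule: int_le_induct) (use that(1,2) down in auto)
  have neg: "infinite {n. n < 0 \<and> \<not> Z n} \<longleftrightarrow> (\<forall>n. n \<le> - int CARD('v) \<longrightarrow> \<not> Z n)"
  proof
    assume inf: "infinite {n. n < 0 \<and> \<not> Z n}"
    show "\<forall>n. n \<le> - int CARD('v) \<longrightarrow> \<not> Z n"
    proof (intro allI impI notI)
      fix n assume n: "n \<le> - int CARD('v)" "Z n"
      have "k \<in> {n..0}" if "k < 0" "\<not> Z k" for k
        using down_all[OF n(2,1), of k] that by (cases "k \<le> n") auto
      then have "{n. n < 0 \<and> \<not> Z n} \<subseteq> {n..0}" by blast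
      with inf show False using finite_subset by blast
    qed
  next
    assume *: "\<forall>n. n \<le> - int CARD('v) \<longrightarrow> \<not> Z n"
    have "n < 0" if "n \<le> - int CARD('v)" for n
      using that zero_less_card_finite[where ?'a = 'v] by linarith
    with * have "{.. - int CARD('v)} \<subseteq> {n. n < 0 \<and> \<not> Z n}" by auto
    then show "infinite {n. n < 0 \<and> \<not> Z n}" using infinite_Iic infinite_super by blast
  qed
  have pos: "infinite {n. n > 0 \<and> \<not> Z n} \<longleftrightarrow> (\<forall>n. n \<ge> 0 \<longrightarrow> \<not> Z n)"
  proof
    assume inf: "infinite {n. n > 0 \<and> \<not> Z n}"
    show "\<forall>n. n \<ge> 0 \<longrightarrow> \<not> Z n"
    proof (intro allI impI notI)
      fix n assume n: "n \<ge> 0" "Z n"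
      have "k \<in> {0..n}" if "k > 0" "\<not> Z k" for k
        using up_all[OF n(2,1), of k] that by (cases "n \<le> k") auto
      then have "{n. n > 0 \<and> \<not> Z n} \<subseteq> {0..n}" by blast
      with inf show False using finite_subset by blast
    qed
  next
    assume *: "\<forall>n. n \<ge> 0 \<longrightarrow> \<not> Z n"
    have "{0<..} \<subseteq> {n. n > 0 \<and> \<not> Z n}" using * by auto
    then show "infinite {n. n > 0 \<and> \<not> Z n}" using infinite_Ioi infinite_super by blast
  qed
  show ?thesis using neg pos unfolding Z_def by blast
qed

end
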